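(* Let $0<\alpha<2$ and let $w(x)=(1-x^2)^{(\alpha-1)/2}$ for $x\in(-1,1)$. Then for every $u\in C_c(-1,1)$, $$ \begin{aligned} \frac12\int_{-1}^1\!\int_{-1}^1\frac{(u(x)-u(y))^2}{|x-y|^{1+\alpha}}\,dx\,dy ={}&\frac12\int_{-1}^1\!\int_{-1}^1\left(\frac{u(x)}{w(x)}-\frac{u(y)}{w(y)}\right)^2\frac{w(x)w(y)}{|x-y|^{1+\alpha}}\,dx\,dy\\ &+2^\alpha\kappa_{1,\alpha}\int_{-1}^1u^2(x)(1-x^2)^{-\alpha}\,dx\\ &+\frac1\alpha\int_{-1}^1u^2(x)\,\phi(x)(1-x^2)^{-\alpha}\,dx, \end{aligned} $$ where $\phi(x)=2^\alpha-(1+x)^\alpha-(1-x)^\alpha$ and $$\kappa_{1,\alpha}=\frac{B\left(\frac{1+\alpha}{2},\frac{2-\alpha}{2}\right)-2^\alpha}{\alpha 2^\alpha}.$$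
   Context: $C_c(a,b)$ denotes the class of all continuous functions $u\colon(a,b)\to\mathbb{R}$ with compact support in $(a,b)$. $B$ is the Euler beta function. The double integrals take values in $[0,\infty]$. The constant $\kappa_{1,\alpha}$ is the case $n=1$ of $\kappa_{n,\alpha}=\pi^{\frac{n-1}{2}}\frac{\Gamma(\frac{1+\alpha}{2})}{\Gamma(\frac{n+\alpha}{2})}\cdot\frac{B\left(\frac{1+\alpha}{2},\frac{2-\alpha}{2}\right)-2^{\alpha}}{\alpha2^{\alpha}}$. *)

theory Defs
  imports "HOL-Analysis.Analysis"
begin

text \<open>
  Functions on \<open>(a,b)\<close> are represented by total functions; the values outside \<open>(a,b)\<close> are
  unconstrained. The support is the closure of the nonvanishing set relative to \<open>(a,b)\<close>, so its
  compactness keeps it away from the endpoints.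
\<close>

definition C_c :: "real \<Rightarrow> real \<Rightarrow> (real \<Rightarrow> real) set" where
  "C_c a b = {u. continuous_on {a<..<b} u \<and>
                 compact ({a<..<b} \<inter> closure (support_on {a<..<b} u))}"

definition kappa :: "nat \<Rightarrow> real \<Rightarrow> real" where
  "kappa n \<alpha> = pi powr ((real n - 1) / 2) * (Gamma ((1 + \<alpha>) / 2) / Gamma ((real n + \<alpha>) / 2)) *
     ((Beta ((1 + \<alpha>) / 2) ((2 - \<alpha>) / 2) - 2 powr \<alpha>) / (\<alpha> * 2 powr \<alpha>))"

lemma kappa_1:
  assumes "0 < \<alpha>"
  shows "kappa 1 \<alpha> = (Beta ((1 + \<alpha>) / 2) ((2 - \<alpha>) / 2) - 2 powr \<alpha>) / (\<alpha> * 2 powr \<alpha>)"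
proof -
  have "Gamma ((1 + \<alpha>) / 2) > 0"
    using assms by (intro Gamma_real_pos) simp
  then show ?thesis
    by (simp add: kappa_def)
qed

definition w :: "real \<Rightarrow> real \<Rightarrow> real" where
  "w \<alpha> x = (1 - x\<^sup>2) powr ((\<alpha> - 1) / 2)"

definition phi :: "real \<Rightarrow> real \<Rightarrow> real" where
  "phi \<alpha> x = 2 powr \<alpha> - (1 + x) powr \<alpha> - (1 - x) powr \<alpha>"

end

theory Submission
  imports Defs
begin

text \<open>
  The identity is a ground state representation. For every positive function \<open>w\<close>,
  \<open>(u(x) - u(y))\<^sup>2\<close> is the sum of \<open>(u(x)/w(x) - u(y)/w(y))\<^sup>2 w(x) w(y)\<close>, of \<open>u(x)\<^sup>2 (w(x) - w(y)) / w(x)\<close>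
  and of \<open>u(y)\<^sup>2 (w(y) - w(x)) / w(y)\<close>. After division by \<open>\<bar>x - y\<bar> powr (1 + \<alpha>)\<close> and integration the
  two energies should therefore differ by \<open>\<integral> u(x)\<^sup>2 V(x) dx\<close>, where the potential \<open>V(x)\<close> is the principal
  value of \<open>\<integral> (w(x) - w(y)) / w(x) \<bar>x - y\<bar> powr (- 1 - \<alpha>) dy\<close> over \<open>(-1, 1)\<close>. It remains to evaluate
  \<open>V\<close>, and to justify the splitting, whose pieces diverge on the diagonal.

  Both become easy when the diagonal is cut out in a way adapted to the interval. The region kept
  is \<open>\<bar>x - y\<bar> > \<epsilon> (1 - x y)\<close>, which is symmetric in \<open>x\<close> and \<open>y\<close>. For fixed \<open>x\<close> the Moebius map
  \<open>t \<mapsto> (x + t) / (1 + x t)\<close> of the interval carries \<open>\<epsilon> < \<bar>t\<bar> < 1\<close> onto the slice at \<open>x\<close>, so the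
  principal value becomes a symmetric one at \<open>t = 0\<close>; and the integral over the slice becomes
  \<open>(1 - x\<^sup>2) powr - \<alpha>\<close> times the integral of
  \<open>((1 + x t) powr (\<alpha> - 1) - (1 - t\<^sup>2) powr ((\<alpha> - 1) / 2)) \<bar>t\<bar> powr (- 1 - \<alpha>)\<close>,
  a difference whose first term does not involve the weight and whose second term does not involve
  \<open>x\<close>. The first term has an elementary primitive; integration by parts reduces the second to a
  Beta integral. The divergent contributions, of size \<open>\<epsilon> powr - \<alpha>\<close>, cancel up to
  \<open>O(\<epsilon> powr (2 - \<alpha>))\<close> uniformly in \<open>x\<close>, and with \<open>B\<close> the Beta value of the theorem this leaves
  \<open>V(x) = (1 - x\<^sup>2) powr - \<alpha> (B - (1 + x) powr \<alpha> - (1 - x) powr \<alpha>) / \<alpha>\<close>. Adding and subtracting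
  \<open>2 powr \<alpha>\<close> in the numerator gives the two correction terms. This computation is
  \<open>moment_difference_bounded_convergence\<close>.

  For fixed \<open>\<epsilon>\<close> everything is kept nonnegative: the negative parts of the pointwise identity are moved
  to the other side, so that Tonelli's theorem alone yields \<open>truncated_ground_state_identity\<close>. As
  \<open>\<epsilon> \<rightarrow> 0\<close> the two double integrals converge by monotone convergence, possibly to \<open>\<infinity>\<close>, and their
  difference, a single integral, by dominated convergence, because the support of \<open>u\<close> stays away from the
  endpoints. This is \<open>hardy_identity_compact_support\<close>.
\<close>

section \<open>Change of variables, powers and the Beta integral\<close>

text \<open>
  For nonnegative integrands gauge integrability is absolute integrability, so either of the two
  integrals exists if the other one does.
\<close>

lemma has_integral_change_of_variables_nonneg:
  fixes f g g' :: "real \<Rightarrow> real"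
  assumes "S \<in> sets lebesgue"
    and "\<And>t. t \<in> S \<Longrightarrow> (g has_field_derivative g' t) (at t within S)"
    and "inj_on g S"
    and nonneg: "\<And>t. t \<in> S \<Longrightarrow> 0 \<le> f (g t)"
  shows "((\<lambda>t. \<bar>g' t\<bar> * f (g t)) has_integral b) S \<longleftrightarrow> (f has_integral b) (g ` S)"
proof -
  have 1: "(\<lambda>t. \<bar>g' t\<bar> * f (g t)) integrable_on S \<Longrightarrow> (\<lambda>t. \<bar>g' t\<bar> * f (g t)) absolutely_integrable_on S"
    by (rule nonnegative_absolutely_integrable_1) (auto simp: nonneg)
  have 2: "f integrable_on g ` S \<Longrightarrow> f absolutely_integrable_on g ` S"
    by (rule nonnegative_absolutely_integrable_1) (auto simp: nonneg)
  show ?thesis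
    using has_absolute_integral_change_of_variables_1'[OF assms(1-3), of f b] 1 2
    by (auto simp: has_integral_iff dest: set_lebesgue_integral_eq_integral(1))
qed

text \<open>
  The first-order terms at \<open>z\<close> and \<open>- z\<close> cancel. The upper bound is Young's inequality for
  \<open>(1 \<plusminus> z)\<^sup>2\<close> with exponent \<open>\<alpha> / 2 \<le> 1\<close>; the lower bound is the inequality of the arithmetic and geometric
  means, since \<open>(1 + z) (1 - z) = 1 - z\<^sup>2\<close>. This is what makes the principal value converge.
\<close>

lemma powr_one_plus_one_minus_bounds:
  fixes \<alpha> z :: real
  assumes "0 < \<alpha>" "\<alpha> \<le> 2" "\<bar>z\<bar> < 1"
  shows "\<bar>(1 + z) powr \<alpha> + (1 - z) powr \<alpha> - 2\<bar> \<le> 2 * z\<^sup>2"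
proof -
  have young: "p powr \<alpha> \<le> 1 + \<alpha> / 2 * (p\<^sup>2 - 1)" if "p > 0" for p :: real
  proof -
    have "(p\<^sup>2) powr (\<alpha> / 2) * 1 powr (1 - \<alpha> / 2) \<le> \<alpha> / 2 * p\<^sup>2 + (1 - \<alpha> / 2) * 1"
      using assms that by (intro Youngs_inequality_0) auto
    moreover have "(p\<^sup>2) powr (\<alpha> / 2) = p powr \<alpha>"
      using that by (simp add: powr_powr flip: powr_numeral)
    ultimately show ?thesis by (simp add: algebra_simps)
  qed
  have "(1 + z) powr \<alpha> + (1 - z) powr \<alpha> \<le> 2 + \<alpha> * z\<^sup>2"
    using young[of "1 + z"] young[of "1 - z"] assms
    by (simp add: power2_eq_square algebra_simps abs_less_iff)
  also have "\<dots> \<le> 2 + 2 * z\<^sup>2"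
    using assms by (intro add_left_mono mult_right_mono) auto
  finally have upper: "(1 + z) powr \<alpha> + (1 - z) powr \<alpha> \<le> 2 + 2 * z\<^sup>2" .
  have z2: "0 < 1 - z\<^sup>2" "1 - z\<^sup>2 \<le> 1"
    using assms by (auto simp: abs_square_less_1)
  have "1 - z\<^sup>2 = (1 - z\<^sup>2) powr 1"
    using z2 by simp
  also have "\<dots> \<le> (1 - z\<^sup>2) powr (\<alpha> / 2)"
    using z2 assms by (intro powr_mono') auto
  also have "(1 - z\<^sup>2) powr (\<alpha> / 2) = (1 + z) powr (\<alpha> / 2) * (1 - z) powr (\<alpha> / 2)"
    using assms by (subst powr_mult [symmetric]) (auto simp: power2_eq_square algebra_simps)
  finally have "2 * (1 - z\<^sup>2) \<le> 2 * ((1 + z) powr (\<alpha> / 2) * (1 - z) powr (\<alpha> / 2))"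
    by simp
  also have "\<dots> \<le> ((1 + z) powr (\<alpha> / 2))\<^sup>2 + ((1 - z) powr (\<alpha> / 2))\<^sup>2"
    using sum_squares_bound[of "(1 + z) powr (\<alpha> / 2)" "(1 - z) powr (\<alpha> / 2)"] by (simp add: mult_ac)
  also have "\<dots> = (1 + z) powr \<alpha> + (1 - z) powr \<alpha>"
    by (simp add: power2_eq_square flip: powr_add)
  finally show ?thesis using upper by (simp add: algebra_simps abs_le_iff)
qed

lemma one_minus_powr_bounds:
  fixes b \<delta> :: real
  assumes "0 \<le> b" "b \<le> 2" "0 \<le> \<delta>" "\<delta> < 1"
  shows "1 - 2 * \<delta> \<le> (1 - \<delta>) powr b" "(1 - \<delta>) powr b \<le> 1"
proof -
  have "1 - 2 * \<delta> \<le> (1 - \<delta>) powr 2"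
    using assms by (simp add: power2_eq_square algebra_simps)
  also have "\<dots> \<le> (1 - \<delta>) powr b"
    using assms by (intro powr_mono') auto
  finally show "1 - 2 * \<delta> \<le> (1 - \<delta>) powr b" .
  show "(1 - \<delta>) powr b \<le> 1"
    using assms by (intro powr_le1) auto
qed

text \<open>
  The Beta integral after the substitution of \<open>t\<^sup>2\<close> for the variable.
\<close>

lemma has_integral_Beta_square:
  fixes a b :: real
  assumes "0 < a" "0 < b"
  shows "((\<lambda>t. t powr (2 * a - 1) * (1 - t\<^sup>2) powr (b - 1)) has_integral Beta a b / 2) {0<..<1}"
proof -
  have img: "(\<lambda>t::real. t\<^sup>2) ` {0<..<1} = {0<..<1}"
  proof (intro set_eqI iffI)
    fix y :: real assume "y \<in> {0<..<1}"
    then show "y \<in> (\<lambda>t::real. t\<^sup>2) ` {0<..<1}"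
      by (intro image_eqI[of _ _ "sqrt y"]) auto
  qed (auto simp: power_less_one_iff)
  have "((\<lambda>t. t powr (a - 1) * (1 - t) powr (b - 1)) has_integral Beta a b) ((\<lambda>t. t\<^sup>2) ` {0<..<1})"
    unfolding img using has_integral_Beta_real[OF assms] by (simp add: has_integral_Icc_iff_Ioo)
  then have "((\<lambda>t. \<bar>2 * t\<bar> * ((t\<^sup>2) powr (a - 1) * (1 - t\<^sup>2) powr (b - 1))) has_integral Beta a b) {0<..<1}"
    by (subst has_integral_change_of_variables_nonneg)
       (auto intro!: derivative_eq_intros inj_onI)
  then have "((\<lambda>t. (1/2) * (\<bar>2 * t\<bar> * ((t\<^sup>2) powr (a - 1) * (1 - t\<^sup>2) powr (b - 1)))) has_integral (1/2) * Beta a b) {0<..<1}"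
    by (rule has_integral_mult_right)
  moreover have "(1/2) * (\<bar>2 * t\<bar> * ((t\<^sup>2) powr (a - 1) * (1 - t\<^sup>2) powr (b - 1))) =
      t powr (2 * a - 1) * (1 - t\<^sup>2) powr (b - 1)" if t: "t \<in> {0<..<1}" for t
  proof -
    have 1: "(t\<^sup>2) powr (a - 1) = t powr (2 * (a - 1))"
      using t by (simp add: powr_powr flip: powr_numeral)
    have 2: "t * t powr (2 * (a - 1)) = t powr (2 * a - 1)"
      using t powr_add[of t 1 "2 * (a - 1)"] by (simp add: algebra_simps)
    show ?thesis
      unfolding 1 2[symmetric] using t by simp
  qed
  ultimately have "((\<lambda>t. t powr (2 * a - 1) * (1 - t\<^sup>2) powr (b - 1)) has_integral (1/2) * Beta a b) {0<..<1}"
    by (rule has_integral_eq[rotated])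
  then show ?thesis by simp
qed

section \<open>Truncated singular integrals on the unit interval\<close>

text \<open>
  The integrand is the derivative of \<open>- (1 + x t) powr \<alpha> * t powr - \<alpha> / \<alpha>\<close>: the factor
  \<open>x t - (1 + x t)\<close> produced by the product rule equals \<open>- 1\<close>.
\<close>

lemma has_integral_one_plus_powr_singular:
  fixes \<alpha> \<epsilon> x :: real
  assumes "0 < \<alpha>" "\<bar>x\<bar> < 1" "0 < \<epsilon>" "\<epsilon> < 1"
  shows "((\<lambda>t. (1 + x * t) powr (\<alpha> - 1) * t powr (- 1 - \<alpha>)) has_integral
      ((1 + x * \<epsilon>) powr \<alpha> * \<epsilon> powr - \<alpha> - (1 + x) powr \<alpha>) / \<alpha>) {\<epsilon><..<1}"
proof -
  define F where "F = (\<lambda>t. - ((1 + x * t) powr \<alpha> * t powr - \<alpha>) / \<alpha>)"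
  have pos: "0 < 1 + x * t" if "\<epsilon> \<le> t" "t \<le> 1" for t
  proof -
    have "\<bar>x * t\<bar> \<le> \<bar>x\<bar> * 1"
      using that assms unfolding abs_mult by (intro mult_left_mono) auto
    then show ?thesis using assms by linarith
  qed
  have deriv: "(F has_real_derivative (1 + x * t) powr (\<alpha> - 1) * t powr (- 1 - \<alpha>)) (at t within A)"
    if "\<epsilon> \<le> t" "t \<le> 1" for t A
  proof -
    have "0 < t" using that assms by simp
    have "(F has_real_derivative
        - (((\<alpha> * (1 + x * t) powr (\<alpha> - of_nat 1) * x) * t powr - \<alpha> +
           (- \<alpha> * t powr (- \<alpha> - of_nat 1) * 1) * (1 + x * t) powr \<alpha>)) / \<alpha>) (at t)"
      unfolding F_def using pos[OF that] \<open>0 < t\<close>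
      by (intro DERIV_cdivide DERIV_minus DERIV_mult DERIV_fun_powr)
         (auto intro!: derivative_eq_intros)
    moreover have "(1 + x * t) powr \<alpha> = (1 + x * t) powr (\<alpha> - 1) * (1 + x * t)"
      using pos[OF that] powr_add[of "1 + x * t" "\<alpha> - 1" 1] by simp
    moreover have "t powr - \<alpha> = t powr (- 1 - \<alpha>) * t"
      using \<open>0 < t\<close> powr_add[of t "- 1 - \<alpha>" 1] by simp
    moreover have "- (((\<alpha> * P * x) * (Q * t) + (- \<alpha> * Q * 1) * (P * (1 + x * t)))) / \<alpha> = P * Q" for P Q
      using assms(1) by (simp add: divide_simps) (simp add: algebra_simps)
    ultimately have "(F has_real_derivative (1 + x * t) powr (\<alpha> - 1) * t powr (- 1 - \<alpha>)) (at t)"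
      by (simp add: minus_diff_commute)
    then show ?thesis by (rule has_field_derivative_at_within)
  qed
  have "((\<lambda>t. (1 + x * t) powr (\<alpha> - 1) * t powr (- 1 - \<alpha>)) has_integral F 1 - F \<epsilon>) {\<epsilon>..1}"
    using assms by (intro fundamental_theorem_of_calculus)
      (auto intro!: deriv simp flip: has_real_derivative_iff_has_vector_derivative)
  moreover have "F 1 - F \<epsilon> = ((1 + x * \<epsilon>) powr \<alpha> * \<epsilon> powr - \<alpha> - (1 + x) powr \<alpha>) / \<alpha>"
    using assms by (simp add: F_def field_simps)
  ultimately show ?thesis by (simp add: has_integral_Icc_iff_Ioo)
qed

text \<open>
  The part over \<open>(\<epsilon>, 1)\<close> of the integral that remains after the integration by parts in
  \<open>has_integral_one_minus_square_powr_singular\<close>; its integrand is integrable up to \<open>0\<close>, so it tends to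
  half of a Beta value.
\<close>

definition beta_tail :: "real \<Rightarrow> real \<Rightarrow> real" where
  "beta_tail \<alpha> \<epsilon> = integral {\<epsilon><..<1} (\<lambda>t. t powr (1 - \<alpha>) * (1 - t\<^sup>2) powr ((\<alpha> - 1) / 2))"

lemma beta_half_integrand_has_integral:
  fixes \<alpha> :: real
  assumes "0 < \<alpha>" "\<alpha> < 2"
  shows "((\<lambda>t. t powr (1 - \<alpha>) * (1 - t\<^sup>2) powr ((\<alpha> - 1) / 2)) has_integral
      Beta ((1 + \<alpha>) / 2) ((2 - \<alpha>) / 2) / 2) {0..1}"
proof -
  have exponents: "2 * ((2 - \<alpha>) / 2) - 1 = 1 - \<alpha>" "(1 + \<alpha>) / 2 - 1 = (\<alpha> - 1) / 2"
    by (simp_all add: field_simps)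
  show ?thesis
    using has_integral_Beta_square[of "(2 - \<alpha>) / 2" "(1 + \<alpha>) / 2", unfolded exponents] assms
    unfolding has_integral_Icc_iff_Ioo by (simp add: Beta_commute)
qed

lemma has_integral_beta_tail:
  fixes \<alpha> \<epsilon> :: real
  assumes "0 < \<alpha>" "\<alpha> < 2" "0 < \<epsilon>" "\<epsilon> < 1"
  shows "((\<lambda>t. t powr (1 - \<alpha>) * (1 - t\<^sup>2) powr ((\<alpha> - 1) / 2)) has_integral beta_tail \<alpha> \<epsilon>) {\<epsilon><..<1}"
proof -
  have "(\<lambda>t. t powr (1 - \<alpha>) * (1 - t\<^sup>2) powr ((\<alpha> - 1) / 2)) integrable_on {\<epsilon>..1}"
  proof (rule integrable_subinterval_real)
    show "(\<lambda>t. t powr (1 - \<alpha>) * (1 - t\<^sup>2) powr ((\<alpha> - 1) / 2)) integrable_on {0..1}"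
      using beta_half_integrand_has_integral[OF assms(1,2)] by (rule has_integral_integrable)
    show "{\<epsilon>..1} \<subseteq> {0..1}" using assms(3) by simp
  qed
  then show ?thesis
    unfolding beta_tail_def integrable_on_Icc_iff_Ioo by (rule integrable_integral)
qed

lemma beta_tail_tendsto:
  fixes \<alpha> :: real and e :: "nat \<Rightarrow> real"
  assumes "0 < \<alpha>" "\<alpha> < 2" "e \<longlonglongrightarrow> 0" "\<And>n. 0 < e n" "\<And>n. e n < 1"
  shows "(\<lambda>n. beta_tail \<alpha> (e n)) \<longlonglongrightarrow> Beta ((1 + \<alpha>) / 2) ((2 - \<alpha>) / 2) / 2"
proof -
  define f where "f = (\<lambda>t. t powr (1 - \<alpha>) * (1 - t\<^sup>2) powr ((\<alpha> - 1) / 2))"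
  note f = beta_half_integrand_has_integral[OF assms(1,2), folded f_def]
  have "continuous_on {0..1} (\<lambda>x. integral {x..1} f)"
    using f by (intro indefinite_integral_continuous_1') (rule has_integral_integrable)
  then have "(\<lambda>n. integral {e n..1} f) \<longlonglongrightarrow> integral {0..1} f"
    by (rule continuous_on_tendsto_compose[OF _ assms(3)]) (auto intro!: always_eventually less_imp_le assms)
  moreover have "integral {e n..1} f = beta_tail \<alpha> (e n)" for n
    unfolding beta_tail_def f_def[symmetric] by (simp add: integral_open_interval_real)
  moreover have "integral {0..1} f = Beta ((1 + \<alpha>) / 2) ((2 - \<alpha>) / 2) / 2"
    using f by (rule integral_unique)
  ultimately show ?thesis by simp
qed

text \<open>
  Integration by parts: with \<open>b = (1 + \<alpha>) / 2\<close> the derivative of \<open>- (1 - t\<^sup>2) powr b * t powr - \<alpha>\<close> is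
  \<open>(1 - t\<^sup>2) powr (b - 1) * t powr (- 1 - \<alpha>) * (\<alpha> + t\<^sup>2)\<close>, where the special value of \<open>b\<close> is what makes the
  coefficient of \<open>t\<^sup>2\<close> equal to \<open>1\<close>. The summand with \<open>t\<^sup>2\<close> is no longer singular at \<open>0\<close>.
\<close>

lemma has_integral_one_minus_square_powr_singular:
  fixes \<alpha> \<epsilon> :: real
  assumes "0 < \<alpha>" "\<alpha> < 2" "0 < \<epsilon>" "\<epsilon> < 1"
  shows "((\<lambda>t. (1 - t\<^sup>2) powr ((\<alpha> - 1) / 2) * t powr (- 1 - \<alpha>)) has_integral
      ((1 - \<epsilon>\<^sup>2) powr ((1 + \<alpha>) / 2) * \<epsilon> powr - \<alpha> - beta_tail \<alpha> \<epsilon>) / \<alpha>) {\<epsilon><..<1}"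
proof -
  define b where "b = (1 + \<alpha>) / 2"
  have b: "b > 0" "(\<alpha> - 1) / 2 = b - 1" "2 * b = 1 + \<alpha>" using assms by (auto simp: b_def field_simps)
  define F where "F = (\<lambda>t::real. - ((1 - t\<^sup>2) powr b * t powr - \<alpha>))"
  define f where "f = (\<lambda>t::real. (1 - t\<^sup>2) powr (b - 1) * t powr (- 1 - \<alpha>))"
  define g where "g = (\<lambda>t::real. t powr (1 - \<alpha>) * (1 - t\<^sup>2) powr (b - 1))"
  have deriv: "(F has_real_derivative \<alpha> * f t + g t) (at t)" if "\<epsilon> < t" "t < 1" for t
  proof -
    have t: "0 < t" "t\<^sup>2 < 1" using that assms by (auto simp: power_less_one_iff)
    have "(F has_real_derivative
        - (((b * (1 - t\<^sup>2) powr (b - of_nat 1) * (- 2 * t)) * t powr - \<alpha> +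
           (- \<alpha> * t powr (- \<alpha> - of_nat 1) * 1) * (1 - t\<^sup>2) powr b))) (at t)"
      unfolding F_def using t
      by (intro DERIV_minus DERIV_mult DERIV_fun_powr)
         (auto intro!: derivative_eq_intros)
    moreover have "(1 - t\<^sup>2) powr b = (1 - t\<^sup>2) powr (b - 1) * (1 - t\<^sup>2)"
      using t powr_add[of "1 - t\<^sup>2" "b - 1" 1] by simp
    moreover have "t powr - \<alpha> = t powr (- 1 - \<alpha>) * t" 
      using t powr_add[of t "- 1 - \<alpha>" 1] by simp
    moreover have "t powr (1 - \<alpha>) = t powr (- 1 - \<alpha>) * t\<^sup>2"
      using t powr_add[of t "- 1 - \<alpha>" 2] by simp
    moreover have "- (((b * P * (- 2 * t)) * (Q * t) + (- \<alpha> * Q * 1) * (P * (1 - t\<^sup>2))))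
        = \<alpha> * (P * Q) + (Q * t\<^sup>2) * P" for P Q
    proof -
      have "- (((b * P * (- 2 * t)) * (Q * t) + (- \<alpha> * Q * 1) * (P * (1 - t\<^sup>2))))
        = (2 * b) * P * Q * t\<^sup>2 + \<alpha> * P * Q * (1 - t\<^sup>2)"
        by (simp add: algebra_simps power2_eq_square)
      then show ?thesis unfolding b by (simp add: algebra_simps)
    qed
    ultimately show ?thesis
      unfolding f_def g_def by (simp add: minus_diff_commute)
  qed
  have "((\<lambda>t. \<alpha> * f t + g t) has_integral F 1 - F \<epsilon>) {\<epsilon>..1}"
  proof (rule fundamental_theorem_of_calculus_interior)
    \<comment> \<open>The derivative may blow up at the right endpoint, but the primitive is continuous there as \<open>b > 0\<close>.\<close>
    show "continuous_on {\<epsilon>..1} F"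
      unfolding F_def using assms b(1)
      by (auto intro!: continuous_intros continuous_on_powr' simp: power_le_one_iff)
  qed (use assms deriv in \<open>auto simp flip: has_real_derivative_iff_has_vector_derivative\<close>)
  then have "((\<lambda>t. \<alpha> * f t + g t) has_integral F 1 - F \<epsilon>) {\<epsilon><..<1}"
    by (simp add: has_integral_Icc_iff_Ioo)
  moreover have "(g has_integral beta_tail \<alpha> \<epsilon>) {\<epsilon><..<1}"
    using has_integral_beta_tail[OF assms] by (simp add: g_def b)
  ultimately have "((\<lambda>t. \<alpha> * f t + g t - g t) has_integral F 1 - F \<epsilon> - beta_tail \<alpha> \<epsilon>) {\<epsilon><..<1}"
    by (rule has_integral_diff)
  then have "((\<lambda>t. (1 / \<alpha>) * (\<alpha> * f t)) has_integral (1 / \<alpha>) * (F 1 - F \<epsilon> - beta_tail \<alpha> \<epsilon>)) {\<epsilon><..<1}"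
    by (intro has_integral_mult_right) simp
  moreover have "(1 / \<alpha>) * (\<alpha> * f t) = (1 - t\<^sup>2) powr ((\<alpha> - 1) / 2) * t powr (- 1 - \<alpha>)" for t
    using assms(1) unfolding f_def b(2) by simp
  moreover have "(1 / \<alpha>) * (F 1 - F \<epsilon> - beta_tail \<alpha> \<epsilon>) =
      ((1 - \<epsilon>\<^sup>2) powr ((1 + \<alpha>) / 2) * \<epsilon> powr - \<alpha> - beta_tail \<alpha> \<epsilon>) / \<alpha>"
    unfolding F_def b_def by simp
  ultimately show ?thesis by (simp only:)
qed

lemma has_integral_symmetric_annulus:
  fixes f :: "real \<Rightarrow> real"
  assumes "(f has_integral I) {\<epsilon><..<1}" "((\<lambda>t. f (- t)) has_integral J) {\<epsilon><..<1}" "0 < \<epsilon>"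
  shows "(f has_integral I + J) {t. \<epsilon> < \<bar>t\<bar> \<and> \<bar>t\<bar> < 1}"
proof -
  have "((\<lambda>t. f (- t)) has_integral J) {- (- \<epsilon>)..- (- 1)}"
    using assms(2) by (simp add: has_integral_Icc_iff_Ioo)
  then have "(f has_integral J) {- 1<..<- \<epsilon>}"
    unfolding has_integral_reflect_real by (simp add: has_integral_Icc_iff_Ioo)
  with assms(1) have "(f has_integral I + J) ({\<epsilon><..<1} \<union> {- 1<..<- \<epsilon>})"
  proof (rule has_integral_Un)
    have "{\<epsilon><..<1} \<inter> {- 1<..<- \<epsilon>} = {}" using assms(3) by auto
    then show "negligible ({\<epsilon><..<1} \<inter> {- 1<..<- \<epsilon>})" by simp
  qed
  also have "{\<epsilon><..<1} \<union> {- 1<..<- \<epsilon>} = {t. \<epsilon> < \<bar>t\<bar> \<and> \<bar>t\<bar> < 1}"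
    using assms(3) by auto
  finally show ?thesis .
qed

text \<open>
  The integrals of \<open>(1 + x t) powr (\<alpha> - 1) * \<bar>t\<bar> powr (- 1 - \<alpha>)\<close> and of
  \<open>(1 - t\<^sup>2) powr ((\<alpha> - 1) / 2) * \<bar>t\<bar> powr (- 1 - \<alpha>)\<close> over \<open>\<epsilon> < \<bar>t\<bar> < 1\<close>, in closed form. Each grows like
  \<open>2 * \<epsilon> powr - \<alpha> / \<alpha>\<close> as \<open>\<epsilon> \<rightarrow> 0\<close>; only their difference has a limit.
\<close>

definition kernel_moment :: "real \<Rightarrow> real \<Rightarrow> real \<Rightarrow> real" where
  "kernel_moment \<alpha> \<epsilon> x = (((1 + x * \<epsilon>) powr \<alpha> + (1 - x * \<epsilon>) powr \<alpha>) * \<epsilon> powr - \<alpha>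
      - ((1 + x) powr \<alpha> + (1 - x) powr \<alpha>)) / \<alpha>"

definition weight_moment :: "real \<Rightarrow> real \<Rightarrow> real" where
  "weight_moment \<alpha> \<epsilon> = 2 * ((1 - \<epsilon>\<^sup>2) powr ((1 + \<alpha>) / 2) * \<epsilon> powr - \<alpha> - beta_tail \<alpha> \<epsilon>) / \<alpha>"

lemma has_integral_kernel_moment:
  fixes \<alpha> \<epsilon> x :: real
  assumes "0 < \<alpha>" "\<bar>x\<bar> < 1" "0 < \<epsilon>" "\<epsilon> < 1"
  shows "((\<lambda>t. (1 + x * t) powr (\<alpha> - 1) * \<bar>t\<bar> powr (- 1 - \<alpha>)) has_integral kernel_moment \<alpha> \<epsilon> x)
      {t. \<epsilon> < \<bar>t\<bar> \<and> \<bar>t\<bar> < 1}"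
proof -
  have 1: "((\<lambda>t. (1 + x * t) powr (\<alpha> - 1) * \<bar>t\<bar> powr (- 1 - \<alpha>)) has_integral
      ((1 + x * \<epsilon>) powr \<alpha> * \<epsilon> powr - \<alpha> - (1 + x) powr \<alpha>) / \<alpha>) {\<epsilon><..<1}"
    by (rule has_integral_eq[OF _ has_integral_one_plus_powr_singular[OF assms]]) (use assms(3) in auto)
  have 2: "((\<lambda>t. (1 + x * - t) powr (\<alpha> - 1) * \<bar>- t\<bar> powr (- 1 - \<alpha>)) has_integral
      ((1 + (- x) * \<epsilon>) powr \<alpha> * \<epsilon> powr - \<alpha> - (1 + (- x)) powr \<alpha>) / \<alpha>) {\<epsilon><..<1}"
    by (rule has_integral_eq[OF _ has_integral_one_plus_powr_singular]) (use assms in auto)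
  have "kernel_moment \<alpha> \<epsilon> x = ((1 + x * \<epsilon>) powr \<alpha> * \<epsilon> powr - \<alpha> - (1 + x) powr \<alpha>) / \<alpha>
      + ((1 + (- x) * \<epsilon>) powr \<alpha> * \<epsilon> powr - \<alpha> - (1 + (- x)) powr \<alpha>) / \<alpha>"
    using assms by (simp add: kernel_moment_def field_simps)
  then show ?thesis
    using has_integral_symmetric_annulus[OF 1 2 assms(3)] by simp
qed

lemma has_integral_weight_moment:
  fixes \<alpha> \<epsilon> :: real
  assumes "0 < \<alpha>" "\<alpha> < 2" "0 < \<epsilon>" "\<epsilon> < 1"
  shows "((\<lambda>t. (1 - t\<^sup>2) powr ((\<alpha> - 1) / 2) * \<bar>t\<bar> powr (- 1 - \<alpha>)) has_integral weight_moment \<alpha> \<epsilon>)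
      {t. \<epsilon> < \<bar>t\<bar> \<and> \<bar>t\<bar> < 1}"
proof -
  have 1: "((\<lambda>t. (1 - t\<^sup>2) powr ((\<alpha> - 1) / 2) * \<bar>t\<bar> powr (- 1 - \<alpha>)) has_integral weight_moment \<alpha> \<epsilon> / 2) {\<epsilon><..<1}"
  proof (rule has_integral_eq[rotated])
    show "((\<lambda>t. (1 - t\<^sup>2) powr ((\<alpha> - 1) / 2) * t powr (- 1 - \<alpha>)) has_integral weight_moment \<alpha> \<epsilon> / 2) {\<epsilon><..<1}"
      by (rule has_integral_eq_rhs[OF has_integral_one_minus_square_powr_singular[OF assms]])
         (use assms(1) in \<open>simp add: weight_moment_def field_simps\<close>)
  qed (use assms(3) in auto)
  show ?thesis
    using has_integral_symmetric_annulus[OF 1 _ assms(3), of "weight_moment \<alpha> \<epsilon> / 2"] 1 by simp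
qed

text \<open>
  The limit is the potential \<open>V\<close> without its factor \<open>(1 - x\<^sup>2) powr - \<alpha>\<close>. The divergent parts are
  \<open>\<epsilon> powr - \<alpha>\<close> times quantities that both equal \<open>2 + O(\<epsilon>\<^sup>2)\<close>, and \<open>\<alpha> < 2\<close>. The bound does not depend on
  \<open>x\<close> and \<open>n\<close>, as dominated convergence will require.
\<close>

lemma moment_difference_bounded_convergence:
  fixes \<alpha> :: real and e :: "nat \<Rightarrow> real"
  assumes "0 < \<alpha>" "\<alpha> < 2" "e \<longlonglongrightarrow> 0" "\<And>n. 0 < e n" "\<And>n. e n < 1" "\<bar>x\<bar> < 1"
  shows "(\<lambda>n. kernel_moment \<alpha> (e n) x - weight_moment \<alpha> (e n)) \<longlonglongrightarrow>
      (Beta ((1 + \<alpha>) / 2) ((2 - \<alpha>) / 2) - (1 + x) powr \<alpha> - (1 - x) powr \<alpha>) / \<alpha>"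
    and "\<bar>kernel_moment \<alpha> (e n) x - weight_moment \<alpha> (e n)\<bar> \<le> (14 + Beta ((1 + \<alpha>) / 2) ((2 - \<alpha>) / 2)) / \<alpha>"
proof -
  define B where "B = Beta ((1 + \<alpha>) / 2) ((2 - \<alpha>) / 2)"
  \<comment> \<open>All terms that are singular as \<open>e n\<close> tends to \<open>0\<close> are collected in \<open>r n\<close>.\<close>
  define r where "r n = ((1 + x * e n) powr \<alpha> + (1 - x * e n) powr \<alpha> - 2 * (1 - (e n)\<^sup>2) powr ((1 + \<alpha>) / 2)) * e n powr - \<alpha>" for n
  have decomp: "kernel_moment \<alpha> (e n) x - weight_moment \<alpha> (e n) =
      (r n + 2 * beta_tail \<alpha> (e n) - (1 + x) powr \<alpha> - (1 - x) powr \<alpha>) / \<alpha>" for n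
    using assms(1) by (simp add: kernel_moment_def weight_moment_def r_def field_simps)
  have r_bound: "\<bar>r n\<bar> \<le> 6 * e n powr (2 - \<alpha>)" for n
  proof -
    have e: "0 < e n" "e n < 1" "(e n)\<^sup>2 < 1" using assms(4,5)[of n] by (auto simp: power_less_one_iff)
    have "x\<^sup>2 \<le> 1" using assms(6) by (simp add: abs_square_le_1 less_imp_le)
    then have "(x * e n)\<^sup>2 \<le> 1 * (e n)\<^sup>2" unfolding power_mult_distrib by (intro mult_right_mono) auto
    moreover have "\<bar>x * e n\<bar> < 1 * 1"
      unfolding abs_mult using assms(6) e by (intro mult_strict_mono') auto
    ultimately have "\<bar>(1 + x * e n) powr \<alpha> + (1 - x * e n) powr \<alpha> - 2\<bar> \<le> 2 * (e n)\<^sup>2"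
      using powr_one_plus_one_minus_bounds[of \<alpha> "x * e n"] assms(1,2) by auto
    moreover have "1 - 2 * (e n)\<^sup>2 \<le> (1 - (e n)\<^sup>2) powr ((1 + \<alpha>) / 2)" "(1 - (e n)\<^sup>2) powr ((1 + \<alpha>) / 2) \<le> 1"
      using one_minus_powr_bounds[of "(1 + \<alpha>) / 2" "(e n)\<^sup>2"] assms(1,2) e by auto
    ultimately have "\<bar>(1 + x * e n) powr \<alpha> + (1 - x * e n) powr \<alpha> - 2 * (1 - (e n)\<^sup>2) powr ((1 + \<alpha>) / 2)\<bar> \<le> 6 * (e n)\<^sup>2"
      by linarith
    then have "\<bar>r n\<bar> \<le> 6 * (e n)\<^sup>2 * e n powr - \<alpha>"
      unfolding r_def abs_mult by (simp add: mult_right_mono)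
    also have "\<dots> = 6 * e n powr (2 - \<alpha>)"
      using e powr_add[of "e n" 2 "- \<alpha>"] by simp
    finally show ?thesis .
  qed
  have "(\<lambda>n. 6 * e n powr (2 - \<alpha>)) \<longlonglongrightarrow> 6 * 0 powr (2 - \<alpha>)"
    using assms by (intro tendsto_intros) (auto intro!: always_eventually less_imp_le)
  then have "(\<lambda>n. 6 * e n powr (2 - \<alpha>)) \<longlonglongrightarrow> 0" by simp
  then have "r \<longlonglongrightarrow> 0"
    by (rule Lim_null_comparison[rotated]) (use r_bound in auto)
  then show "(\<lambda>n. kernel_moment \<alpha> (e n) x - weight_moment \<alpha> (e n)) \<longlonglongrightarrow> (B - (1 + x) powr \<alpha> - (1 - x) powr \<alpha>) / \<alpha>"
    unfolding decomp using beta_tail_tendsto[OF assms(1-5)] assms(1)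
    by (auto intro!: tendsto_eq_intros simp: B_def)
  \<comment> \<open>The constant \<open>14\<close> is \<open>6 + 4 + 4\<close>: \<open>r n\<close> is at most \<open>6\<close> in absolute value, each power of
    \<open>1 \<plusminus> x\<close> is at most \<open>4\<close>, and the Beta tails stay below the full Beta value.\<close>
  have "6 * e n powr (2 - \<alpha>) \<le> 6 * 1"
    using assms(2) assms(4,5)[of n] by (intro mult_left_mono powr_le1) auto
  with r_bound[of n] have "\<bar>r n\<bar> \<le> 6" by simp
  moreover have "0 \<le> beta_tail \<alpha> (e n)"
    unfolding beta_tail_def by (intro integral_nonneg has_integral_integrable[OF has_integral_beta_tail] assms) auto
  moreover have "2 * beta_tail \<alpha> (e n) \<le> B"
  proof -
    have "beta_tail \<alpha> (e n) \<le> B / 2"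
      unfolding B_def
      by (rule has_integral_subset_le[OF _ has_integral_beta_tail beta_half_integrand_has_integral])
         (use assms(4)[of n] assms(5)[of n] assms(1,2) in auto)
    then show ?thesis by simp
  qed
  moreover have "(1 + x) powr \<alpha> \<le> 4" "(1 - x) powr \<alpha> \<le> 4"
  proof -
    have "p powr \<alpha> \<le> 4" if "0 \<le> p" "p \<le> 2" for p :: real
    proof -
      have "p powr \<alpha> \<le> 2 powr \<alpha>" using that assms by (intro powr_mono2) auto
      also have "\<dots> \<le> 2 powr 2" using assms by (intro powr_mono) auto
      finally show ?thesis by simp
    qed
    then show "(1 + x) powr \<alpha> \<le> 4" "(1 - x) powr \<alpha> \<le> 4" using assms(6) by auto
  qed
  moreover have "0 \<le> (1 + x) powr \<alpha>" "0 \<le> (1 - x) powr \<alpha>" by simp_all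
  ultimately have "\<bar>r n + 2 * beta_tail \<alpha> (e n) - (1 + x) powr \<alpha> - (1 - x) powr \<alpha>\<bar> \<le> 14 + B"
    by linarith
  then show "\<bar>kernel_moment \<alpha> (e n) x - weight_moment \<alpha> (e n)\<bar> \<le> (14 + B) / \<alpha>"
    unfolding decomp abs_divide using assms(1) by (simp add: divide_right_mono)
qed

section \<open>The Moebius substitution\<close>

text \<open>
  In terms of the pseudohyperbolic distance \<open>\<bar>x - y\<bar> / (1 - x * y)\<close> of the interval, this is the set of
  points at distance more than \<open>\<epsilon>\<close> from \<open>x\<close>. This distance is invariant under the Moebius maps below.
\<close>

definition slice :: "real \<Rightarrow> real \<Rightarrow> real set" where
  "slice \<epsilon> x = {y. \<bar>y\<bar> < 1 \<and> \<epsilon> * (1 - x * y) < \<bar>x - y\<bar>}"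

lemma one_plus_mult_pos:
  fixes x t :: real
  assumes "\<bar>x\<bar> < 1" "\<bar>t\<bar> < 1"
  shows "0 < 1 + x * t"
proof -
  have "\<bar>x * t\<bar> < 1 * 1"
    unfolding abs_mult using assms by (intro mult_strict_mono') auto
  then show ?thesis by linarith
qed

lemma moebius_identities:
  fixes x t :: real
  assumes "\<bar>x\<bar> < 1" "\<bar>t\<bar> < 1"
  defines "y \<equiv> (x + t) / (1 + x * t)"
  shows "x - y = - (t * (1 - x\<^sup>2) / (1 + x * t))"
    and "1 - y\<^sup>2 = (1 - x\<^sup>2) * (1 - t\<^sup>2) / (1 + x * t)\<^sup>2"
    and "1 - x * y = (1 - x\<^sup>2) / (1 + x * t)"
    and "\<bar>y\<bar> < 1"
proof -
  note pos = one_plus_mult_pos[OF assms(1,2)]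
  show "x - y = - (t * (1 - x\<^sup>2) / (1 + x * t))" "1 - x * y = (1 - x\<^sup>2) / (1 + x * t)"
    unfolding y_def using pos by (simp_all add: divide_simps power2_eq_square) (simp_all add: algebra_simps)
  show y2: "1 - y\<^sup>2 = (1 - x\<^sup>2) * (1 - t\<^sup>2) / (1 + x * t)\<^sup>2"
    unfolding y_def power_divide using pos
    by (simp add: divide_simps) (simp add: power2_eq_square algebra_simps)
  have "0 < 1 - y\<^sup>2"
    unfolding y2 using assms(1,2) pos by (auto intro!: divide_pos_pos mult_pos_pos simp: abs_square_less_1)
  then show "\<bar>y\<bar> < 1" by (simp add: abs_square_less_1)
qed

text \<open>
  The map is an isometry for the pseudohyperbolic distance and sends \<open>0\<close> to \<open>x\<close>; the distance of \<open>t\<close> from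
  \<open>0\<close> is \<open>\<bar>t\<bar>\<close>. Its inverse is the map of the same form with \<open>- x\<close> for \<open>x\<close>.
\<close>

lemma moebius_image_annulus:
  fixes x \<epsilon> :: real
  assumes "\<bar>x\<bar> < 1"
  shows "(\<lambda>t. (x + t) / (1 + x * t)) ` {t. \<epsilon> < \<bar>t\<bar> \<and> \<bar>t\<bar> < 1} = slice \<epsilon> x"
proof -
  have x2: "0 < 1 - x\<^sup>2" using assms by (simp add: abs_square_less_1)
  have iff: "\<epsilon> < \<bar>t\<bar> \<longleftrightarrow> \<epsilon> * (1 - x * y) < \<bar>x - y\<bar>"
    if "\<bar>t\<bar> < 1" "y = (x + t) / (1 + x * t)" for t y
  proof -
    have p: "0 < (1 - x\<^sup>2) / (1 + x * t)" using x2 one_plus_mult_pos[OF assms that(1)] by simp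
    have "\<bar>x - y\<bar> = \<bar>t\<bar> * ((1 - x\<^sup>2) / (1 + x * t))"
      unfolding that(2) moebius_identities(1)[OF assms that(1)]
      using x2 one_plus_mult_pos[OF assms that(1)] by (simp add: abs_mult)
    moreover have "1 - x * y = (1 - x\<^sup>2) / (1 + x * t)"
      unfolding that(2) by (rule moebius_identities(3)[OF assms that(1)])
    ultimately show ?thesis using p mult_less_cancel_right_pos by metis
  qed
  show ?thesis
  proof (intro set_eqI iffI)
    fix y assume "y \<in> (\<lambda>t. (x + t) / (1 + x * t)) ` {t. \<epsilon> < \<bar>t\<bar> \<and> \<bar>t\<bar> < 1}"
    then obtain t where "\<epsilon> < \<bar>t\<bar>" "\<bar>t\<bar> < 1" "y = (x + t) / (1 + x * t)" by auto
    moreover from this have "\<bar>y\<bar> < 1" using moebius_identities(4)[OF assms, of t] by simp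
    ultimately show "y \<in> slice \<epsilon> x" using iff[of t y] unfolding slice_def by blast
  next
    fix y assume y: "y \<in> slice \<epsilon> x"
    define t where "t = (y + - x) / (1 + y * - x)"
    have y1: "\<bar>y\<bar> < 1" using y by (auto simp: slice_def)
    have pos: "0 < 1 + y * - x" using one_plus_mult_pos[of y "- x"] assms y1 by simp
    have t1: "\<bar>t\<bar> < 1" unfolding t_def using moebius_identities(4)[of y "- x"] y1 assms by simp
    have "x + t = y * (1 + x * t)"
      unfolding t_def using pos by (simp add: divide_simps) (simp add: algebra_simps)
    then have yt: "y = (x + t) / (1 + x * t)"
      using one_plus_mult_pos[OF assms t1] by (simp add: field_simps)
    then have "\<epsilon> < \<bar>t\<bar>" using iff[OF t1 yt] y unfolding slice_def by blast
    then show "y \<in> (\<lambda>t. (x + t) / (1 + x * t)) ` {t. \<epsilon> < \<bar>t\<bar> \<and> \<bar>t\<bar> < 1}"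
      using yt t1 by blast
  qed
qed

lemma inj_on_moebius:
  fixes x :: real
  assumes "\<bar>x\<bar> < 1"
  shows "inj_on (\<lambda>t. (x + t) / (1 + x * t)) {t. \<bar>t\<bar> < 1}"
proof (rule inj_onI)
  fix s t :: real
  assume st: "s \<in> {t. \<bar>t\<bar> < 1}" "t \<in> {t. \<bar>t\<bar> < 1}" and eq: "(x + s) / (1 + x * s) = (x + t) / (1 + x * t)"
  then have "(x + s) * (1 + x * t) = (x + t) * (1 + x * s)"
    using one_plus_mult_pos[OF assms, of s] one_plus_mult_pos[OF assms, of t] by (simp add: frac_eq_eq)
  then have "(1 - x\<^sup>2) * (s - t) = 0" by (simp add: algebra_simps power2_eq_square)
  moreover have "1 - x\<^sup>2 > 0" using assms by (simp add: abs_square_less_1)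
  ultimately show "s = t" by simp
qed

lemma has_integral_moebius:
  fixes f :: "real \<Rightarrow> real"
  assumes "\<bar>x\<bar> < 1" and nonneg: "\<And>y. 0 \<le> f y"
  shows "((\<lambda>t. (1 - x\<^sup>2) / (1 + x * t)\<^sup>2 * f ((x + t) / (1 + x * t))) has_integral b)
      {t. \<epsilon> < \<bar>t\<bar> \<and> \<bar>t\<bar> < 1} \<longleftrightarrow> (f has_integral b) (slice \<epsilon> x)"
proof -
  let ?S = "{t::real. \<epsilon> < \<bar>t\<bar> \<and> \<bar>t\<bar> < 1}"
  let ?g = "\<lambda>t. (x + t) / (1 + x * t)"
  have "open ?S" by (intro open_Collect_conj open_Collect_less continuous_intros)
  then have S: "?S \<in> sets lebesgue" by (intro sets_completionI_sets) auto
  have deriv: "(?g has_real_derivative (1 - x\<^sup>2) / (1 + x * t)\<^sup>2) (at t within ?S)" if "t \<in> ?S" for t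
  proof -
    have "(?g has_real_derivative (1 * (1 + x * t) - (x + t) * x) / ((1 + x * t) * (1 + x * t))) (at t within ?S)"
      using one_plus_mult_pos[OF assms(1), of t] that
      by (intro DERIV_divide) (auto intro!: derivative_eq_intros)
    then show ?thesis by (simp add: power2_eq_square algebra_simps)
  qed
  have "inj_on ?g ?S" by (rule inj_on_subset[OF inj_on_moebius[OF assms(1)]]) auto
  note * = has_integral_change_of_variables_nonneg[OF S deriv this, of f b]
  have "\<bar>1 - x\<^sup>2\<bar> = 1 - x\<^sup>2"
    using assms(1) by (simp add: abs_square_le_1 less_imp_le)
  then show ?thesis
    using * nonneg by (simp add: moebius_image_annulus[OF assms(1)])
qed

text \<open>
  The reason for choosing the Moebius map: the kernel together with the Jacobian, and also the
  weight, is transformed into a function of \<open>x\<close> times a power of \<open>1 + x * t\<close> times a function of \<open>t\<close>.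
  In the product of these two expressions the powers of \<open>1 + x * t\<close> cancel, because the exponent in
  \<^const>\<open>w\<close> is \<open>(\<alpha> - 1) / 2\<close>.
\<close>

lemma moebius_kernel:
  fixes x t :: real
  assumes "\<bar>x\<bar> < 1" "\<bar>t\<bar> < 1"
  defines "y \<equiv> (x + t) / (1 + x * t)"
  shows "(1 - x\<^sup>2) / (1 + x * t)\<^sup>2 * \<bar>x - y\<bar> powr (- 1 - \<alpha>) =
      (1 - x\<^sup>2) powr - \<alpha> * ((1 + x * t) powr (\<alpha> - 1) * \<bar>t\<bar> powr (- 1 - \<alpha>))"
    and "w \<alpha> y = w \<alpha> x * ((1 - t\<^sup>2) powr ((\<alpha> - 1) / 2) * (1 + x * t) powr (1 - \<alpha>))"
proof -
  define p where "p = 1 + x * t"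
  define q where "q = 1 - x\<^sup>2"
  have pos: "0 < p" "0 < q"
    using one_plus_mult_pos[OF assms(1,2)] assms(1) by (auto simp: p_def q_def abs_square_less_1)
  have d: "\<bar>x - y\<bar> = \<bar>t\<bar> * q / p"
    using moebius_identities(1)[OF assms(1,2)] pos unfolding y_def p_def q_def by (simp add: abs_mult)
  have "q / p\<^sup>2 * (\<bar>t\<bar> * q / p) powr (- 1 - \<alpha>) =
      q powr 1 * p powr - 2 * (\<bar>t\<bar> powr (- 1 - \<alpha>) * q powr (- 1 - \<alpha>) * p powr (1 + \<alpha>))"
    using pos by (simp add: powr_mult powr_divide powr_minus_divide powr_diff powr_add field_simps)
  also have "\<dots> = (q powr 1 * q powr (- 1 - \<alpha>)) * (p powr - 2 * p powr (1 + \<alpha>)) * \<bar>t\<bar> powr (- 1 - \<alpha>)"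
    by (simp only: mult_ac)
  also have "\<dots> = q powr - \<alpha> * (p powr (\<alpha> - 1) * \<bar>t\<bar> powr (- 1 - \<alpha>))"
  proof -
    have "q powr 1 * q powr (- 1 - \<alpha>) = q powr - \<alpha>" by (subst powr_add[symmetric]) simp
    moreover have "p powr - 2 * p powr (1 + \<alpha>) = p powr (\<alpha> - 1)" by (subst powr_add[symmetric]) simp
    ultimately show ?thesis by (simp only: mult.assoc)
  qed
  finally show "(1 - x\<^sup>2) / (1 + x * t)\<^sup>2 * \<bar>x - y\<bar> powr (- 1 - \<alpha>) =
      (1 - x\<^sup>2) powr - \<alpha> * ((1 + x * t) powr (\<alpha> - 1) * \<bar>t\<bar> powr (- 1 - \<alpha>))"
    unfolding d p_def q_def .
  have t: "0 \<le> 1 - t\<^sup>2" using assms(2) by (simp add: abs_square_le_1 less_imp_le)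
  have "w \<alpha> y = (q * (1 - t\<^sup>2) / p\<^sup>2) powr ((\<alpha> - 1) / 2)"
    unfolding w_def y_def moebius_identities(2)[OF assms(1,2)] p_def q_def ..
  also have "\<dots> = q powr ((\<alpha> - 1) / 2) * (1 - t\<^sup>2) powr ((\<alpha> - 1) / 2) / (p\<^sup>2) powr ((\<alpha> - 1) / 2)"
    using pos t by (simp add: powr_mult powr_divide)
  also have "(p\<^sup>2) powr ((\<alpha> - 1) / 2) = p powr (2 * ((\<alpha> - 1) / 2))"
    using pos by (simp only: powr_powr powr_numeral[symmetric])
  also have "2 * ((\<alpha> - 1) / 2) = \<alpha> - 1" by simp
  also have "q powr ((\<alpha> - 1) / 2) * (1 - t\<^sup>2) powr ((\<alpha> - 1) / 2) / p powr (\<alpha> - 1) =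
      q powr ((\<alpha> - 1) / 2) * ((1 - t\<^sup>2) powr ((\<alpha> - 1) / 2) * p powr (1 - \<alpha>))"
    using pos by (simp add: powr_diff field_simps)
  finally show "w \<alpha> y = w \<alpha> x * ((1 - t\<^sup>2) powr ((\<alpha> - 1) / 2) * (1 + x * t) powr (1 - \<alpha>))"
    unfolding w_def p_def q_def .
qed

lemma has_integral_kernel_slice:
  fixes \<alpha> \<epsilon> x :: real
  assumes "0 < \<alpha>" "\<bar>x\<bar> < 1" "0 < \<epsilon>" "\<epsilon> < 1"
  shows "((\<lambda>y. \<bar>x - y\<bar> powr (- 1 - \<alpha>)) has_integral (1 - x\<^sup>2) powr - \<alpha> * kernel_moment \<alpha> \<epsilon> x) (slice \<epsilon> x)"
proof (subst has_integral_moebius[symmetric])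
  show "((\<lambda>t. (1 - x\<^sup>2) / (1 + x * t)\<^sup>2 * \<bar>x - (x + t) / (1 + x * t)\<bar> powr (- 1 - \<alpha>)) has_integral
      (1 - x\<^sup>2) powr - \<alpha> * kernel_moment \<alpha> \<epsilon> x) {t. \<epsilon> < \<bar>t\<bar> \<and> \<bar>t\<bar> < 1}"
    by (rule has_integral_eq[OF moebius_kernel(1)[OF assms(2), symmetric]
          has_integral_mult_right[OF has_integral_kernel_moment[OF assms]]]) auto
qed (use assms in auto)

lemma has_integral_weighted_kernel_slice:
  fixes \<alpha> \<epsilon> x :: real
  assumes "0 < \<alpha>" "\<alpha> < 2" "\<bar>x\<bar> < 1" "0 < \<epsilon>" "\<epsilon> < 1"
  shows "((\<lambda>y. w \<alpha> y / w \<alpha> x * \<bar>x - y\<bar> powr (- 1 - \<alpha>)) has_integral (1 - x\<^sup>2) powr - \<alpha> * weight_moment \<alpha> \<epsilon>) (slice \<epsilon> x)"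
proof (subst has_integral_moebius[symmetric])
  have x2: "0 < 1 - x\<^sup>2" using assms(3) by (simp add: abs_square_less_1)
  show "((\<lambda>t. (1 - x\<^sup>2) / (1 + x * t)\<^sup>2 * (w \<alpha> ((x + t) / (1 + x * t)) / w \<alpha> x * \<bar>x - (x + t) / (1 + x * t)\<bar> powr (- 1 - \<alpha>)))
      has_integral (1 - x\<^sup>2) powr - \<alpha> * weight_moment \<alpha> \<epsilon>) {t. \<epsilon> < \<bar>t\<bar> \<and> \<bar>t\<bar> < 1}"
  proof (rule has_integral_eq[OF _ has_integral_mult_right[OF has_integral_weight_moment]])
    fix t assume "t \<in> {t. \<epsilon> < \<bar>t\<bar> \<and> \<bar>t\<bar> < 1}"
    then have t: "\<bar>t\<bar> < 1" by simp
    note pos = one_plus_mult_pos[OF assms(3) t]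
    have "0 < w \<alpha> x" using x2 by (simp add: w_def)
    then have quot: "w \<alpha> ((x + t) / (1 + x * t)) / w \<alpha> x = (1 - t\<^sup>2) powr ((\<alpha> - 1) / 2) * (1 + x * t) powr (1 - \<alpha>)"
      unfolding moebius_kernel(2)[OF assms(3) t] by simp
    have "(1 + x * t) powr (1 - \<alpha>) * (1 + x * t) powr (\<alpha> - 1) = 1"
      using pos by (simp flip: powr_add)
    then have "(1 - x\<^sup>2) powr - \<alpha> * ((1 - t\<^sup>2) powr ((\<alpha> - 1) / 2) * \<bar>t\<bar> powr (- 1 - \<alpha>)) =
       ((1 - t\<^sup>2) powr ((\<alpha> - 1) / 2) * (1 + x * t) powr (1 - \<alpha>)) *
       ((1 - x\<^sup>2) powr - \<alpha> * ((1 + x * t) powr (\<alpha> - 1) * \<bar>t\<bar> powr (- 1 - \<alpha>)))"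
      by (simp add: mult_ac)
    also have "\<dots> = (1 - x\<^sup>2) / (1 + x * t)\<^sup>2 *
       (w \<alpha> ((x + t) / (1 + x * t)) / w \<alpha> x * \<bar>x - (x + t) / (1 + x * t)\<bar> powr (- 1 - \<alpha>))"
      unfolding quot moebius_kernel(1)[OF assms(3) t, symmetric] by (simp add: mult_ac)
    finally show "(1 - x\<^sup>2) powr - \<alpha> * ((1 - t\<^sup>2) powr ((\<alpha> - 1) / 2) * \<bar>t\<bar> powr (- 1 - \<alpha>)) =
       (1 - x\<^sup>2) / (1 + x * t)\<^sup>2 *
       (w \<alpha> ((x + t) / (1 + x * t)) / w \<alpha> x * \<bar>x - (x + t) / (1 + x * t)\<bar> powr (- 1 - \<alpha>))" .
  qed (use assms in auto)
qed (use assms in \<open>auto simp: w_def\<close>)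

section \<open>The truncated ground state representation\<close>

text \<open>
  A compact subset of the open interval has a positive distance from the endpoints, and \<open>u\<close> is bounded
  on it by continuity.
\<close>

lemma C_c_bounds:
  assumes "u \<in> C_c (-1) 1"
  obtains c M where "0 \<le> c" "c < 1" "\<And>x. \<bar>x\<bar> < 1 \<Longrightarrow> c < \<bar>x\<bar> \<Longrightarrow> u x = 0" "\<And>x. \<bar>x\<bar> < 1 \<Longrightarrow> \<bar>u x\<bar> \<le> M"
proof -
  define K where "K = {-1<..<1} \<inter> closure (support_on {-1<..<1::real} u)"
  have K: "compact K" and cont: "continuous_on {-1<..<1} u"
    using assms by (auto simp: C_c_def K_def)
  have zero: "u x = 0" if "\<bar>x\<bar> < 1" "x \<notin> K" for x
  proof (rule ccontr)
    assume "u x \<noteq> 0"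
    then have "x \<in> support_on {-1<..<1} u" using that(1) by (auto simp: support_on_def)
    then have "x \<in> K" using that(1) closure_subset by (auto simp: K_def)
    with that(2) show False by simp
  qed
  have "bounded (u ` K)"
    by (intro compact_imp_bounded compact_continuous_image K continuous_on_subset[OF cont]) (auto simp: K_def)
  then obtain M where M: "\<And>x. x \<in> K \<Longrightarrow> \<bar>u x\<bar> \<le> M"
    by (auto simp: bounded_iff)
  have "\<exists>c. 0 \<le> c \<and> c < 1 \<and> (\<forall>x\<in>K. \<bar>x\<bar> \<le> c)"
  proof (cases "K = {}")
    case True
    then show ?thesis by (intro exI[of _ 0]) auto
  next
    case False
    have "continuous_on K (\<lambda>x. \<bar>x\<bar>)" by (intro continuous_intros)
    then obtain z where "z \<in> K" "\<forall>x\<in>K. \<bar>x\<bar> \<le> \<bar>z\<bar>"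
      using continuous_attains_sup[OF K False] by blast
    then show ?thesis by (intro exI[of _ "\<bar>z\<bar>"]) (auto simp: K_def)
  qed
  then obtain c where c: "0 \<le> c" "c < 1" "\<forall>x\<in>K. \<bar>x\<bar> \<le> c" by blast
  show ?thesis
  proof (rule that[of c "max M 0"])
    show "u x = 0" if "\<bar>x\<bar> < 1" "c < \<bar>x\<bar>" for x using zero[OF that(1)] c(3) that(2) by fastforce
    show "\<bar>u x\<bar> \<le> max M 0" if "\<bar>x\<bar> < 1" for x using zero[OF that] M[of x] by fastforce
  qed (use c in auto)
qed

lemma w_pos:
  assumes "\<bar>x\<bar> < 1"
  shows "0 < w \<alpha> x"
proof -
  have "x\<^sup>2 < 1" using assms by (simp add: abs_square_less_1)
  then show ?thesis by (simp add: w_def)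
qed

lemma borel_measurable_w [measurable]: "w \<alpha> \<in> borel_measurable borel"
  unfolding w_def[abs_def] by measurable

definition truncated_square :: "real \<Rightarrow> (real \<times> real) set" where
  "truncated_square \<epsilon> = {(x, y). \<bar>x\<bar> < 1 \<and> y \<in> slice \<epsilon> x}"

lemma truncated_square_sym: "(y, x) \<in> truncated_square \<epsilon> \<longleftrightarrow> (x, y) \<in> truncated_square \<epsilon>"
  by (auto simp: truncated_square_def slice_def abs_minus_commute mult.commute)

lemma sets_truncated_square [measurable]: "truncated_square \<epsilon> \<in> sets (borel \<Otimes>\<^sub>M borel)"
proof -
  have "truncated_square \<epsilon> = {p \<in> space (borel \<Otimes>\<^sub>M borel). \<bar>fst p\<bar> < 1 \<and> \<bar>snd p\<bar> < 1 \<and>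
      \<epsilon> * (1 - fst p * snd p) < \<bar>fst p - snd p\<bar>}"
    by (auto simp: truncated_square_def slice_def space_pair_measure)
  also have "\<dots> \<in> sets (borel \<Otimes>\<^sub>M borel)" by measurable
  finally show ?thesis .
qed

text \<open>
  The pointwise ground state representation, with \<open>p\<close> and \<open>q\<close> the values of the weight, \<open>a\<close> and \<open>b\<close>
  those of the function and \<open>k\<close> that of the kernel. Negative terms have been moved to the other
  side, so that it can be integrated term by term in \<open>[0, \<infinity>]\<close>.
\<close>

lemma ground_state_identity:
  fixes p q a b k :: real
  assumes "0 < p" "0 < q"
  shows "(b - a)\<^sup>2 * k + (a\<^sup>2 * (q / p * k) + b\<^sup>2 * (p / q * k)) =
      (b / q - a / p)\<^sup>2 * (q * p * k) + (a\<^sup>2 * k + b\<^sup>2 * k)"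
proof -
  define P where "P = p / q"
  define Q where "Q = q / p"
  have "(b / q - a / p)\<^sup>2 * (q * p) = b\<^sup>2 * P - 2 * a * b + a\<^sup>2 * Q"
    unfolding P_def Q_def using assms by (simp add: divide_simps) (simp add: power2_eq_square algebra_simps)
  then have "(b / q - a / p)\<^sup>2 * (q * p * k) = (b\<^sup>2 * P - 2 * a * b + a\<^sup>2 * Q) * k"
    by (metis mult.assoc)
  then show ?thesis
    unfolding P_def[symmetric] Q_def[symmetric] by (simp add: algebra_simps power2_eq_square)
qed

abbreviation trunc_integral :: "real \<Rightarrow> (real \<Rightarrow> real \<Rightarrow> real) \<Rightarrow> ennreal" where
  "trunc_integral \<epsilon> f \<equiv> \<integral>\<^sup>+p. ennreal (indicator (truncated_square \<epsilon>) p * f (fst p) (snd p)) \<partial>(lborel \<Otimes>\<^sub>M lborel)"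

lemma trunc_integral_swap:
  fixes f :: "real \<Rightarrow> real \<Rightarrow> real"
  assumes [measurable]: "case_prod f \<in> borel_measurable (borel \<Otimes>\<^sub>M borel)"
  shows "trunc_integral \<epsilon> (\<lambda>x y. f y x) = trunc_integral \<epsilon> f"
proof -
  have [measurable]: "(\<lambda>p. f (fst p) (snd p)) \<in> borel_measurable (borel \<Otimes>\<^sub>M borel)"
    using assms by (simp add: case_prod_beta')
  have [measurable]: "(\<lambda>p. f (snd p) (fst p)) \<in> borel_measurable (borel \<Otimes>\<^sub>M borel)"
    using measurable_compose[OF measurable_pair_swap' assms] by (simp add: case_prod_beta')
  have m1: "(\<lambda>p. ennreal (indicator (truncated_square \<epsilon>) p * f (fst p) (snd p))) \<in> borel_measurable (lborel \<Otimes>\<^sub>M lborel)"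
    by measurable
  have m2: "(\<lambda>p. ennreal (indicator (truncated_square \<epsilon>) p * f (snd p) (fst p))) \<in> borel_measurable (lborel \<Otimes>\<^sub>M lborel)"
    by measurable
  have "trunc_integral \<epsilon> (\<lambda>x y. f y x) =
      (\<integral>\<^sup>+y. \<integral>\<^sup>+x. ennreal (indicator (truncated_square \<epsilon>) (x, y) * f y x) \<partial>lborel \<partial>lborel)"
    by (subst lborel_pair.nn_integral_snd[OF m2, symmetric]) simp
  also have "\<dots> = (\<integral>\<^sup>+y. \<integral>\<^sup>+x. ennreal (indicator (truncated_square \<epsilon>) (y, x) * f y x) \<partial>lborel \<partial>lborel)"
    by (simp add: indicator_def truncated_square_sym)
  also have "\<dots> = trunc_integral \<epsilon> f"
    by (subst lborel.nn_integral_fst[OF m1, symmetric]) simp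
  finally show ?thesis .
qed

text \<open>
  Tonelli's theorem, for the case that the integrals over the slices are known.
\<close>

lemma trunc_integral_slice:
  fixes f :: "real \<Rightarrow> real \<Rightarrow> real"
  assumes [measurable]: "case_prod f \<in> borel_measurable (borel \<Otimes>\<^sub>M borel)"
    and nonneg: "\<And>x y. \<bar>x\<bar> < 1 \<Longrightarrow> \<bar>y\<bar> < 1 \<Longrightarrow> 0 \<le> f x y"
    and I: "\<And>x. \<bar>x\<bar> < 1 \<Longrightarrow> (f x has_integral I x) (slice \<epsilon> x)"
  shows "trunc_integral \<epsilon> f = (\<integral>\<^sup>+x. ennreal (indicator {-1<..<1} x * I x) \<partial>lborel)"
proof -
  have [measurable]: "(\<lambda>p. f (fst p) (snd p)) \<in> borel_measurable (borel \<Otimes>\<^sub>M borel)"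
    using assms(1) by (simp add: case_prod_beta')
  have m1: "(\<lambda>p. ennreal (indicator (truncated_square \<epsilon>) p * f (fst p) (snd p))) \<in> borel_measurable (lborel \<Otimes>\<^sub>M lborel)"
    by measurable
  have "trunc_integral \<epsilon> f =
      (\<integral>\<^sup>+x. \<integral>\<^sup>+y. ennreal (indicator (truncated_square \<epsilon>) (x, y) * f x y) \<partial>lborel \<partial>lborel)"
    by (subst lborel.nn_integral_fst[OF m1, symmetric]) simp
  also have "\<dots> = (\<integral>\<^sup>+x. ennreal (indicator {-1<..<1} x * I x) \<partial>lborel)"
  proof (rule nn_integral_cong)
    fix x :: real
    show "(\<integral>\<^sup>+y. ennreal (indicator (truncated_square \<epsilon>) (x, y) * f x y) \<partial>lborel) = ennreal (indicator {-1<..<1} x * I x)"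
    proof (cases "\<bar>x\<bar> < 1")
      case True
      then have ind: "indicator (truncated_square \<epsilon>) (x, y) = (indicator (slice \<epsilon> x) y :: real)" for y
        by (simp add: truncated_square_def indicator_def)
      have "(\<integral>\<^sup>+y. ennreal (indicator (slice \<epsilon> x) y * f x y) \<partial>lborel) = ennreal (I x)"
        by (rule nn_integral_has_integral_lebesgue[OF _ I[OF True]]) (auto simp: slice_def intro!: nonneg True)
      moreover have "indicator {-1<..<1} x = (1 :: real)" using True by (simp add: indicator_def abs_less_iff)
      ultimately show ?thesis by (simp add: ind)
    next
      case False
      then have "indicator {-1<..<1} x = (0 :: real)" by (auto simp: indicator_def)
      then show ?thesis using False by (simp add: truncated_square_def)
    qed
  qed
  finally show ?thesis .
qed

text \<open>
  Integrating \<open>ground_state_identity\<close> over the truncated square. Because this region is symmetric, the two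
  terms that differ by interchanging \<open>x\<close> and \<open>y\<close> have equal integrals, which explains the factors \<open>2\<close>.
\<close>

lemma truncated_ground_state_identity:
  fixes v :: "real \<Rightarrow> real"
  assumes "0 < \<alpha>" "\<alpha> < 2" "0 < \<epsilon>" "\<epsilon> < 1" and [measurable]: "v \<in> borel_measurable borel"
  shows "trunc_integral \<epsilon> (\<lambda>x y. (v y - v x)\<^sup>2 * \<bar>y - x\<bar> powr (- 1 - \<alpha>))
      + 2 * (\<integral>\<^sup>+x. ennreal (indicator {-1<..<1} x * ((v x)\<^sup>2 * ((1 - x\<^sup>2) powr - \<alpha> * weight_moment \<alpha> \<epsilon>))) \<partial>lborel)
    = trunc_integral \<epsilon> (\<lambda>x y. (v y / w \<alpha> y - v x / w \<alpha> x)\<^sup>2 * (w \<alpha> y * w \<alpha> x * \<bar>y - x\<bar> powr (- 1 - \<alpha>)))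
      + 2 * (\<integral>\<^sup>+x. ennreal (indicator {-1<..<1} x * ((v x)\<^sup>2 * ((1 - x\<^sup>2) powr - \<alpha> * kernel_moment \<alpha> \<epsilon> x))) \<partial>lborel)"
    (is "?A + 2 * ?M = ?B + 2 * ?P")
proof -
  define m where "m = (\<lambda>x y. (v x)\<^sup>2 * (w \<alpha> y / w \<alpha> x * \<bar>x - y\<bar> powr (- 1 - \<alpha>)))"
  define q where "q = (\<lambda>x y. (v x)\<^sup>2 * \<bar>x - y\<bar> powr (- 1 - \<alpha>))"
  define a where "a = (\<lambda>x y. (v y - v x)\<^sup>2 * \<bar>y - x\<bar> powr (- 1 - \<alpha>))"
  define b where "b = (\<lambda>x y. (v y / w \<alpha> y - v x / w \<alpha> x)\<^sup>2 * (w \<alpha> y * w \<alpha> x * \<bar>y - x\<bar> powr (- 1 - \<alpha>)))"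
  have meas: "case_prod m \<in> borel_measurable (borel \<Otimes>\<^sub>M borel)" "case_prod q \<in> borel_measurable (borel \<Otimes>\<^sub>M borel)"
    unfolding m_def q_def by measurable
  have [measurable]: "(\<lambda>p. m (fst p) (snd p)) \<in> borel_measurable (borel \<Otimes>\<^sub>M borel)"
      "(\<lambda>p. m (snd p) (fst p)) \<in> borel_measurable (borel \<Otimes>\<^sub>M borel)"
      "(\<lambda>p. q (fst p) (snd p)) \<in> borel_measurable (borel \<Otimes>\<^sub>M borel)"
      "(\<lambda>p. q (snd p) (fst p)) \<in> borel_measurable (borel \<Otimes>\<^sub>M borel)"
      "(\<lambda>p. a (fst p) (snd p)) \<in> borel_measurable (borel \<Otimes>\<^sub>M borel)"
      "(\<lambda>p. b (fst p) (snd p)) \<in> borel_measurable (borel \<Otimes>\<^sub>M borel)"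
    unfolding m_def q_def a_def b_def by measurable
  have w_nonneg: "0 \<le> w \<alpha> x" for x by (simp add: w_def)
  have nonneg: "0 \<le> m x y" "0 \<le> q x y" "0 \<le> a x y" "0 \<le> b x y" for x y
    by (auto simp: m_def q_def a_def b_def intro!: mult_nonneg_nonneg divide_nonneg_nonneg w_nonneg)
  have M: "trunc_integral \<epsilon> m = ?M"
  proof (rule trunc_integral_slice[OF meas(1) nonneg(1)])
    show "(m x has_integral (v x)\<^sup>2 * ((1 - x\<^sup>2) powr - \<alpha> * weight_moment \<alpha> \<epsilon>)) (slice \<epsilon> x)" if "\<bar>x\<bar> < 1" for x
      unfolding m_def by (intro has_integral_mult_right has_integral_weighted_kernel_slice assms that)
  qed
  have P: "trunc_integral \<epsilon> q = ?P"
  proof (rule trunc_integral_slice[OF meas(2) nonneg(2)])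
    show "(q x has_integral (v x)\<^sup>2 * ((1 - x\<^sup>2) powr - \<alpha> * kernel_moment \<alpha> \<epsilon> x)) (slice \<epsilon> x)" if "\<bar>x\<bar> < 1" for x
      unfolding q_def by (intro has_integral_mult_right has_integral_kernel_slice assms that)
  qed
  have pointwise: "ennreal (indicator (truncated_square \<epsilon>) p * a (fst p) (snd p)) +
      (ennreal (indicator (truncated_square \<epsilon>) p * m (fst p) (snd p)) + ennreal (indicator (truncated_square \<epsilon>) p * m (snd p) (fst p))) =
      ennreal (indicator (truncated_square \<epsilon>) p * b (fst p) (snd p)) +
      (ennreal (indicator (truncated_square \<epsilon>) p * q (fst p) (snd p)) + ennreal (indicator (truncated_square \<epsilon>) p * q (snd p) (fst p)))" for p
  proof (cases "p \<in> truncated_square \<epsilon>")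
    case True
    then obtain x y where p: "p = (x, y)" "\<bar>x\<bar> < 1" "\<bar>y\<bar> < 1"
      by (auto simp: truncated_square_def slice_def)
    have "a x y + (m x y + m y x) = b x y + (q x y + q y x)"
      using ground_state_identity[OF w_pos[OF p(2)] w_pos[OF p(3)], where ?a = "v x" and ?b = "v y"]
      unfolding a_def b_def m_def q_def by (simp add: abs_minus_commute)
    then show ?thesis using True nonneg by (simp add: p(1) flip: ennreal_plus)
  qed simp
  have "trunc_integral \<epsilon> a + (trunc_integral \<epsilon> m + trunc_integral \<epsilon> (\<lambda>x y. m y x)) =
      trunc_integral \<epsilon> b + (trunc_integral \<epsilon> q + trunc_integral \<epsilon> (\<lambda>x y. q y x))"
    by (simp add: nn_integral_add[symmetric] pointwise)
  then show ?thesis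
    unfolding trunc_integral_swap[OF meas(1)] trunc_integral_swap[OF meas(2)] M P mult_2
    unfolding a_def b_def .
qed

text \<open>
  Monotone convergence: the truncated squares increase to the square without its diagonal. The vanishing
  of \<open>f\<close> on the diagonal makes the convergence pointwise everywhere.
\<close>

lemma trunc_integral_tendsto:
  fixes f :: "real \<Rightarrow> real \<Rightarrow> real"
  assumes "case_prod f \<in> borel_measurable (borel \<Otimes>\<^sub>M borel)" and diag: "\<And>x. f x x = 0"
    and e: "e \<longlonglongrightarrow> 0" "decseq e" "\<And>n. 0 < e n"
  shows "(\<lambda>n. trunc_integral (e n) f) \<longlonglongrightarrow>
      (\<integral>\<^sup>+x\<in>{-1<..<1}. (\<integral>\<^sup>+y\<in>{-1<..<1}. ennreal (f x y) \<partial>lborel) \<partial>lborel)"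
proof -
  have [measurable]: "(\<lambda>p. f (fst p) (snd p)) \<in> borel_measurable (borel \<Otimes>\<^sub>M borel)"
    using assms(1) by (simp add: case_prod_beta')
  define g where "g = (\<lambda>p. ennreal (f (fst p) (snd p)) * indicator ({-1<..<1} \<times> {-1<..<1}) p)"
  have [measurable]: "g \<in> borel_measurable (borel \<Otimes>\<^sub>M borel)" unfolding g_def by measurable
  have g: "g \<in> borel_measurable (lborel \<Otimes>\<^sub>M lborel)" by measurable
  have "(\<lambda>n. trunc_integral (e n) f) \<longlonglongrightarrow> integral\<^sup>N (lborel \<Otimes>\<^sub>M lborel) g"
  proof (rule nn_integral_LIMSEQ)
    have sub: "truncated_square (e m) \<subseteq> truncated_square (e n)" if "m \<le> n" for m n
    proof
      fix p assume "p \<in> truncated_square (e m)"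
      then obtain x y where p: "p = (x, y)" "\<bar>x\<bar> < 1" "\<bar>y\<bar> < 1" "e m * (1 - x * y) < \<bar>x - y\<bar>"
        by (auto simp: truncated_square_def slice_def)
      have "0 < 1 - x * y" using one_plus_mult_pos[of x "- y"] p by simp
      then have "e n * (1 - x * y) \<le> e m * (1 - x * y)"
        using decseqD[OF e(2) that] by simp
      then show "p \<in> truncated_square (e n)" using p by (simp add: truncated_square_def slice_def)
    qed
    show "incseq (\<lambda>n p. ennreal (indicator (truncated_square (e n)) p * f (fst p) (snd p)))"
      using sub by (force simp: incseq_def le_fun_def indicator_def)
    show "(\<lambda>p. ennreal (indicator (truncated_square (e n)) p * f (fst p) (snd p))) \<in> borel_measurable (lborel \<Otimes>\<^sub>M lborel)" for n
      by measurable
    fix p :: "real \<times> real"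
    show "(\<lambda>n. ennreal (indicator (truncated_square (e n)) p * f (fst p) (snd p))) \<longlonglongrightarrow> g p"
    proof (cases "fst p \<noteq> snd p \<and> p \<in> {-1<..<1} \<times> {-1<..<1}")
      case True
      then obtain x y where p: "p = (x, y)" "\<bar>x\<bar> < 1" "\<bar>y\<bar> < 1" "x \<noteq> y" by (cases p) auto
      have "(\<lambda>n. e n * (1 - x * y)) \<longlonglongrightarrow> 0 * (1 - x * y)" by (intro tendsto_intros e)
      then have "\<forall>\<^sub>F n in sequentially. e n * (1 - x * y) < \<bar>x - y\<bar>"
        by (rule order_tendstoD) (use p in simp)
      then have "\<forall>\<^sub>F n in sequentially. ennreal (indicator (truncated_square (e n)) p * f (fst p) (snd p)) = g p"
      proof eventually_elim
        case (elim n)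
        then have "p \<in> truncated_square (e n)" using p by (simp add: truncated_square_def slice_def)
        then show ?case using True by (simp add: g_def)
      qed
      then show ?thesis by (rule tendsto_eventually)
    next
      case False
      then have "indicator (truncated_square (e n)) p * f (fst p) (snd p) = 0" for n
        using diag by (cases p) (auto simp: truncated_square_def slice_def indicator_def)
      then have "(\<lambda>n. ennreal (indicator (truncated_square (e n)) p * f (fst p) (snd p))) = (\<lambda>_. 0)"
        by (simp only: ennreal_0)
      moreover have "g p = 0" using False diag by (cases p) (auto simp: g_def indicator_def)
      ultimately show ?thesis by simp
    qed
  qed
  also have "integral\<^sup>N (lborel \<Otimes>\<^sub>M lborel) g = (\<integral>\<^sup>+x. \<integral>\<^sup>+y. g (x, y) \<partial>lborel \<partial>lborel)"
    by (rule lborel.nn_integral_fst[OF g, symmetric])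
  also have "\<dots> = (\<integral>\<^sup>+x\<in>{-1<..<1}. (\<integral>\<^sup>+y\<in>{-1<..<1}. ennreal (f x y) \<partial>lborel) \<partial>lborel)"
    by (intro nn_integral_cong) (simp add: g_def indicator_times split: split_indicator)
  finally show ?thesis .
qed

section \<open>Removing the truncation\<close>

text \<open>
  On the support of \<open>v\<close> the singular factor at the endpoints is at most \<open>(1 - c\<^sup>2) powr - \<alpha>\<close>.
\<close>

lemma integrable_weighted_square:
  fixes v k :: "real \<Rightarrow> real"
  assumes \<alpha>: "0 < \<alpha>" and [measurable]: "v \<in> borel_measurable borel" "k \<in> borel_measurable borel"
    and c: "0 \<le> c" "c < 1" and supp: "\<And>x. c < \<bar>x\<bar> \<Longrightarrow> v x = 0" and bound: "\<And>x. \<bar>v x\<bar> \<le> M"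
    and k: "\<And>x. \<bar>x\<bar> < 1 \<Longrightarrow> \<bar>k x\<bar> \<le> K"
  shows "integrable lborel (\<lambda>x. (v x)\<^sup>2 * (1 - x\<^sup>2) powr - \<alpha> * k x)"
proof (rule integrableI_bounded_set[where A = "{-c..c}" and B = "M\<^sup>2 * (1 - c\<^sup>2) powr - \<alpha> * K"])
  show "(\<lambda>x. (v x)\<^sup>2 * (1 - x\<^sup>2) powr - \<alpha> * k x) \<in> borel_measurable lborel" by measurable
  show "emeasure lborel {-c..c} < \<infinity>" by (simp add: emeasure_lborel_Icc_eq)
  show "AE x\<in>{-c..c} in lborel. norm ((v x)\<^sup>2 * (1 - x\<^sup>2) powr - \<alpha> * k x) \<le> M\<^sup>2 * (1 - c\<^sup>2) powr - \<alpha> * K"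
  proof (intro AE_I2 impI)
    fix x assume "x \<in> {-c..c}"
    then have x: "\<bar>x\<bar> \<le> c" by auto
    have v: "(v x)\<^sup>2 \<le> M\<^sup>2" using power_mono[OF bound[of x], of 2] by simp
    have "x\<^sup>2 \<le> c\<^sup>2" using power_mono[OF x, of 2] by simp
    moreover have "c\<^sup>2 < 1" using c by (simp add: power_less_one_iff)
    ultimately have p: "(1 - x\<^sup>2) powr - \<alpha> \<le> (1 - c\<^sup>2) powr - \<alpha>"
      using \<alpha> by (intro powr_mono2') auto
    have "norm ((v x)\<^sup>2 * (1 - x\<^sup>2) powr - \<alpha> * k x) = (v x)\<^sup>2 * (1 - x\<^sup>2) powr - \<alpha> * \<bar>k x\<bar>"
      by (simp add: abs_mult)
    also have "\<dots> \<le> M\<^sup>2 * (1 - c\<^sup>2) powr - \<alpha> * K"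
      using k[of x] x c by (intro mult_mono v p) auto
    finally show "norm ((v x)\<^sup>2 * (1 - x\<^sup>2) powr - \<alpha> * k x) \<le> M\<^sup>2 * (1 - c\<^sup>2) powr - \<alpha> * K" .
  qed
  show "AE x in lborel. x \<notin> {-c..c} \<longrightarrow> (v x)\<^sup>2 * (1 - x\<^sup>2) powr - \<alpha> * k x = 0"
  proof (intro AE_I2 impI)
    fix x assume "x \<notin> {-c..c}"
    then have "c < \<bar>x\<bar>" by auto
    then show "(v x)\<^sup>2 * (1 - x\<^sup>2) powr - \<alpha> * k x = 0" using supp by simp
  qed
qed simp

lemma weight_moment_nonneg:
  assumes "0 < \<alpha>" "\<alpha> < 2" "0 < \<epsilon>" "\<epsilon> < 1"
  shows "0 \<le> weight_moment \<alpha> \<epsilon>"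
  by (rule has_integral_nonneg[OF has_integral_weight_moment[OF assms]]) simp

lemma kernel_moment_nonneg:
  assumes "0 < \<alpha>" "\<bar>x\<bar> < 1" "0 < \<epsilon>" "\<epsilon> < 1"
  shows "0 \<le> kernel_moment \<alpha> \<epsilon> x"
  by (rule has_integral_nonneg[OF has_integral_kernel_moment[OF assms]]) simp

lemma borel_measurable_kernel_moment [measurable]: "kernel_moment \<alpha> \<epsilon> \<in> borel_measurable borel"
  unfolding kernel_moment_def[abs_def] by measurable

text \<open>
  The limit of \<open>truncated_ground_state_identity\<close>, with the potential still in one piece. The double
  integrals can be infinite, but only simultaneously, since they differ by a real number.
\<close>

lemma hardy_identity_compact_support:
  fixes v :: "real \<Rightarrow> real"
  assumes \<alpha>: "0 < \<alpha>" "\<alpha> < 2" and v [measurable]: "v \<in> borel_measurable borel"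
    and c: "0 \<le> c" "c < 1" and supp: "\<And>x. c < \<bar>x\<bar> \<Longrightarrow> v x = 0" and bound: "\<And>x. \<bar>v x\<bar> \<le> M"
  shows "ereal (1/2) * enn2ereal (\<integral>\<^sup>+x\<in>{-1<..<1}. (\<integral>\<^sup>+y\<in>{-1<..<1}.
        ennreal ((v y - v x)\<^sup>2 * \<bar>y - x\<bar> powr (- 1 - \<alpha>)) \<partial>lborel) \<partial>lborel)
     = ereal (1/2) * enn2ereal (\<integral>\<^sup>+x\<in>{-1<..<1}. (\<integral>\<^sup>+y\<in>{-1<..<1}.
        ennreal ((v y / w \<alpha> y - v x / w \<alpha> x)\<^sup>2 * (w \<alpha> y * w \<alpha> x * \<bar>y - x\<bar> powr (- 1 - \<alpha>)))
          \<partial>lborel) \<partial>lborel)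
     + ereal (LINT x|lborel. (v x)\<^sup>2 * (1 - x\<^sup>2) powr - \<alpha> *
        ((Beta ((1 + \<alpha>) / 2) ((2 - \<alpha>) / 2) - (1 + x) powr \<alpha> - (1 - x) powr \<alpha>) / \<alpha>))"
    (is "ereal (1/2) * enn2ereal ?A = ereal (1/2) * enn2ereal ?B + ereal ?R")
proof -
  define a where "a = (\<lambda>x y. (v y - v x)\<^sup>2 * \<bar>y - x\<bar> powr (- 1 - \<alpha>))"
  define b where "b = (\<lambda>x y. (v y / w \<alpha> y - v x / w \<alpha> x)\<^sup>2 * (w \<alpha> y * w \<alpha> x * \<bar>y - x\<bar> powr (- 1 - \<alpha>)))"
  have meas: "case_prod a \<in> borel_measurable (borel \<Otimes>\<^sub>M borel)" "case_prod b \<in> borel_measurable (borel \<Otimes>\<^sub>M borel)"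
    unfolding a_def b_def by measurable
  \<comment> \<open>The shift by \<open>2\<close> keeps \<open>e n\<close> below \<open>1\<close>.\<close>
  define e where "e = (\<lambda>n. 1 / real (n + 2))"
  have e: "e \<longlonglongrightarrow> 0" "decseq e" "0 < e n" "e n < 1" for n
  proof -
    show "e \<longlonglongrightarrow> 0"
      unfolding e_def by (rule LIMSEQ_ignore_initial_segment[OF lim_1_over_n])
    show "decseq e" by (auto simp: decseq_def e_def intro!: divide_left_mono)
  qed (simp_all add: e_def)
  define h where "h = (\<lambda>x. (v x)\<^sup>2 * (1 - x\<^sup>2) powr - \<alpha>)"
  have [measurable]: "h \<in> borel_measurable borel" unfolding h_def by measurable
  have h_nonneg: "0 \<le> h x" for x by (simp add: h_def)
  have h_supp: "h x = 0" if "c < \<bar>x\<bar>" for x using supp[OF that] by (simp add: h_def)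
  define L where "L = (\<lambda>x. (Beta ((1 + \<alpha>) / 2) ((2 - \<alpha>) / 2) - (1 + x) powr \<alpha> - (1 - x) powr \<alpha>) / \<alpha>)"
  define D where "D = (14 + Beta ((1 + \<alpha>) / 2) ((2 - \<alpha>) / 2)) / \<alpha>"
  have J: "(\<lambda>n. kernel_moment \<alpha> (e n) x - weight_moment \<alpha> (e n)) \<longlonglongrightarrow> L x" "\<bar>kernel_moment \<alpha> (e n) x - weight_moment \<alpha> (e n)\<bar> \<le> D"
    if "\<bar>x\<bar> < 1" for x n
    unfolding L_def D_def using moment_difference_bounded_convergence[OF \<alpha> e(1,3,4) that] by auto
  have int_h: "integrable lborel h"
    using integrable_weighted_square[OF \<alpha>(1) v _ c supp bound, of "\<lambda>_. 1" 1] by (simp add: h_def)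
  have int_M: "integrable lborel (\<lambda>x. h x * weight_moment \<alpha> (e n))" for n
    using int_h by simp
  have bound_diff: "\<bar>h x * (kernel_moment \<alpha> (e n) x - weight_moment \<alpha> (e n))\<bar> \<le> h x * D" for x n
  proof (cases "\<bar>x\<bar> \<le> c")
    case True
    then show ?thesis unfolding abs_mult using J(2)[of x n] c h_nonneg by (simp add: mult_left_mono)
  next
    case False
    then show ?thesis using h_supp[of x] by simp
  qed
  have int_diff: "integrable lborel (\<lambda>x. h x * (kernel_moment \<alpha> (e n) x - weight_moment \<alpha> (e n)))" for n
    unfolding h_def by (rule integrable_weighted_square[OF \<alpha>(1) v _ c supp bound J(2)]) measurable
  have int_P: "integrable lborel (\<lambda>x. h x * kernel_moment \<alpha> (e n) x)" for n
    using Bochner_Integration.integrable_add[OF int_diff int_M, of n n] by (simp add: algebra_simps)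
  define r where "r n = (LINT x|lborel. h x * (kernel_moment \<alpha> (e n) x - weight_moment \<alpha> (e n)))" for n
  have "r \<longlonglongrightarrow> (LINT x|lborel. h x * L x)"
    unfolding r_def
  proof (rule integral_dominated_convergence[where w = "\<lambda>x. h x * D"])
    show "AE x in lborel. (\<lambda>n. h x * (kernel_moment \<alpha> (e n) x - weight_moment \<alpha> (e n))) \<longlonglongrightarrow> h x * L x"
    proof (intro AE_I2)
      fix x
      show "(\<lambda>n. h x * (kernel_moment \<alpha> (e n) x - weight_moment \<alpha> (e n))) \<longlonglongrightarrow> h x * L x"
      proof (cases "\<bar>x\<bar> \<le> c")
        case True
        then show ?thesis using J(1)[of x] c by (intro tendsto_mult_left) auto
      qed (use h_supp[of x] in simp)
    qed
  qed (use int_h bound_diff in \<open>auto simp: L_def\<close>)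
  then have r: "r \<longlonglongrightarrow> ?R" by (simp add: h_def L_def)
  \<comment> \<open>The two one-dimensional integrals are finite, so one of them can be subtracted in \<^typ>\<open>ereal\<close>.\<close>
  have step: "ereal (1/2) * enn2ereal (trunc_integral (e n) a) = ereal (1/2) * enn2ereal (trunc_integral (e n) b) + ereal (r n)" for n
  proof -
    define m where "m = (LINT x|lborel. h x * weight_moment \<alpha> (e n))"
    define p where "p = (LINT x|lborel. h x * kernel_moment \<alpha> (e n) x)"
    have ind: "indicator {-1<..<1} x * ((v x)\<^sup>2 * ((1 - x\<^sup>2) powr - \<alpha> * z)) = h x * z" for x z
    proof (cases "\<bar>x\<bar> \<le> c")
      case True
      then have "x \<in> {-1<..<1}" using c by auto
      then show ?thesis by (simp add: h_def)
    next
      case False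
      then have "v x = 0" using supp by simp
      then show ?thesis by (simp add: h_def)
    qed
    have "(\<integral>\<^sup>+x. ennreal (indicator {-1<..<1} x * ((v x)\<^sup>2 * ((1 - x\<^sup>2) powr - \<alpha> * weight_moment \<alpha> (e n)))) \<partial>lborel) = ennreal m"
      unfolding ind m_def by (intro nn_integral_eq_integral int_M) (simp add: h_nonneg weight_moment_nonneg \<alpha> e)
    moreover have nn_p: "0 \<le> h x * kernel_moment \<alpha> (e n) x" for x
    proof (cases "\<bar>x\<bar> \<le> c")
      case True
      then show ?thesis using c \<alpha> e h_nonneg by (intro mult_nonneg_nonneg kernel_moment_nonneg) auto
    qed (use h_supp[of x] in simp)
    then have "(\<integral>\<^sup>+x. ennreal (indicator {-1<..<1} x * ((v x)\<^sup>2 * ((1 - x\<^sup>2) powr - \<alpha> * kernel_moment \<alpha> (e n) x))) \<partial>lborel) = ennreal p"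
      unfolding ind p_def by (intro nn_integral_eq_integral int_P) simp
    ultimately have eq: "trunc_integral (e n) a + 2 * ennreal m = trunc_integral (e n) b + 2 * ennreal p"
      using truncated_ground_state_identity[OF \<alpha> e(3)[of n] e(4)[of n] v] unfolding a_def b_def by simp
    have nonneg: "0 \<le> m" "0 \<le> p"
      unfolding m_def p_def using nn_p by (auto intro!: integral_nonneg_AE simp: h_nonneg weight_moment_nonneg \<alpha> e)
    have "r n = p - m"
      unfolding r_def m_def p_def using int_P int_M by (simp add: right_diff_distrib)
    moreover have "enn2ereal (trunc_integral (e n) a) + ereal (2 * m) = enn2ereal (trunc_integral (e n) b) + ereal (2 * p)"
    proof -
      have "enn2ereal (trunc_integral (e n) a + ennreal (2 * m)) = enn2ereal (trunc_integral (e n) b + ennreal (2 * p))"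
        using eq by (simp add: ennreal_mult nonneg)
      then show ?thesis using nonneg by (simp add: plus_ennreal.rep_eq)
    qed
    ultimately show ?thesis
      by (cases "enn2ereal (trunc_integral (e n) a)"; cases "enn2ereal (trunc_integral (e n) b)") auto
  qed
  have A: "(\<lambda>n. ereal (1/2) * enn2ereal (trunc_integral (e n) a)) \<longlonglongrightarrow> ereal (1/2) * enn2ereal ?A"
    using trunc_integral_tendsto[OF meas(1) _ e(1-3)]
    by (intro tendsto_cmult_ereal tendsto_enn2erealI) (auto simp: a_def)
  have B: "(\<lambda>n. ereal (1/2) * enn2ereal (trunc_integral (e n) b) + ereal (r n)) \<longlonglongrightarrow> ereal (1/2) * enn2ereal ?B + ereal ?R"
    using trunc_integral_tendsto[OF meas(2) _ e(1-3)] r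
    by (intro tendsto_add_ereal_general1 tendsto_cmult_ereal tendsto_enn2erealI) (auto simp: b_def)
  show ?thesis
    using A B unfolding step by (rule LIMSEQ_unique)
qed

theorem theorem1:
  fixes \<alpha> :: real and u :: "real \<Rightarrow> real"
  assumes "0 < \<alpha>" and "\<alpha> < 2" and "u \<in> C_c (-1) 1"
  shows
    "ereal (1/2) * enn2ereal (\<integral>\<^sup>+y\<in>{-1<..<1}. (\<integral>\<^sup>+x\<in>{-1<..<1}.
        ennreal ((u x - u y)\<^sup>2 / \<bar>x - y\<bar> powr (1 + \<alpha>)) \<partial>lborel) \<partial>lborel)
     = ereal (1/2) * enn2ereal (\<integral>\<^sup>+y\<in>{-1<..<1}. (\<integral>\<^sup>+x\<in>{-1<..<1}.
        ennreal ((u x / w \<alpha> x - u y / w \<alpha> y)\<^sup>2 * (w \<alpha> x * w \<alpha> y / \<bar>x - y\<bar> powr (1 + \<alpha>)))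
          \<partial>lborel) \<partial>lborel)
     + ereal (2 powr \<alpha> * kappa 1 \<alpha> *
        (LINT x:{-1<..<1}|lborel. (u x)\<^sup>2 * (1 - x\<^sup>2) powr (- \<alpha>)))
     + ereal (1 / \<alpha> *
        (LINT x:{-1<..<1}|lborel. (u x)\<^sup>2 * phi \<alpha> x * (1 - x\<^sup>2) powr (- \<alpha>)))"
proof -
  obtain c M where c: "0 \<le> c" "c < 1" and supp: "\<And>x. \<bar>x\<bar> < 1 \<Longrightarrow> c < \<bar>x\<bar> \<Longrightarrow> u x = 0"
    and bound: "\<And>x. \<bar>x\<bar> < 1 \<Longrightarrow> \<bar>u x\<bar> \<le> M"
    using C_c_bounds[OF assms(3)] by metis
  \<comment> \<open>The values of \<open>u\<close> outside the interval are arbitrary, so \<open>u\<close> itself need not be measurable.\<close>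
  define v where "v = (\<lambda>x. indicator {-1<..<1} x * u x)"
  have "continuous_on {-1<..<1} u" using assms(3) by (simp add: C_c_def)
  then have "(\<lambda>x. indicator {-1<..<1} x *\<^sub>R u x) \<in> borel_measurable borel"
    by (intro borel_measurable_continuous_on_indicator) auto
  then have v: "v \<in> borel_measurable borel" by (simp add: v_def)
  have v_supp: "v x = 0" if "c < \<bar>x\<bar>" for x
    using supp[of x] that by (cases "\<bar>x\<bar> < 1") (auto simp: v_def indicator_def)
  have "0 \<le> M" using bound[of 0] by simp
  then have v_bound: "\<bar>v x\<bar> \<le> M" for x using bound[of x] by (auto simp: v_def indicator_def)
  have vu: "v x = u x" if "x \<in> {-1<..<1}" for x using that by (simp add: v_def)
  have inv: "z / \<bar>x\<bar> powr (1 + \<alpha>) = z * \<bar>x\<bar> powr (- 1 - \<alpha>)" for x z :: real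
  proof -
    have "- 1 - \<alpha> = - (1 + \<alpha>)" by simp
    then show ?thesis by (simp only: powr_minus divide_inverse)
  qed
  have lhs: "(\<integral>\<^sup>+y\<in>{-1<..<1}. (\<integral>\<^sup>+x\<in>{-1<..<1}.
        ennreal ((u x - u y)\<^sup>2 / \<bar>x - y\<bar> powr (1 + \<alpha>)) \<partial>lborel) \<partial>lborel) =
     (\<integral>\<^sup>+y\<in>{-1<..<1}. (\<integral>\<^sup>+x\<in>{-1<..<1}.
        ennreal ((v x - v y)\<^sup>2 * \<bar>x - y\<bar> powr (- 1 - \<alpha>)) \<partial>lborel) \<partial>lborel)"
    unfolding inv by (intro nn_integral_cong) (auto simp: vu indicator_def intro!: nn_integral_cong)
  have rhs: "(\<integral>\<^sup>+y\<in>{-1<..<1}. (\<integral>\<^sup>+x\<in>{-1<..<1}.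
        ennreal ((u x / w \<alpha> x - u y / w \<alpha> y)\<^sup>2 * (w \<alpha> x * w \<alpha> y / \<bar>x - y\<bar> powr (1 + \<alpha>))) \<partial>lborel) \<partial>lborel) =
     (\<integral>\<^sup>+y\<in>{-1<..<1}. (\<integral>\<^sup>+x\<in>{-1<..<1}.
        ennreal ((v x / w \<alpha> x - v y / w \<alpha> y)\<^sup>2 * (w \<alpha> x * w \<alpha> y * \<bar>x - y\<bar> powr (- 1 - \<alpha>))) \<partial>lborel) \<partial>lborel)"
    unfolding inv by (intro nn_integral_cong) (auto simp: vu indicator_def intro!: nn_integral_cong)
  define h where "h = (\<lambda>x. (v x)\<^sup>2 * (1 - x\<^sup>2) powr - \<alpha>)"
  define \<beta> where "\<beta> = Beta ((1 + \<alpha>) / 2) ((2 - \<alpha>) / 2)"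
  have "\<bar>phi \<alpha> x\<bar> \<le> 3 * 2 powr \<alpha>" if "\<bar>x\<bar> < 1" for x
  proof -
    have "(1 + x) powr \<alpha> \<le> 2 powr \<alpha>" "(1 - x) powr \<alpha> \<le> 2 powr \<alpha>"
      using that assms(1) by (auto intro!: powr_mono2)
    moreover have "0 \<le> (1 + x) powr \<alpha>" "0 \<le> (1 - x) powr \<alpha>" by simp_all
    ultimately show ?thesis unfolding phi_def by linarith
  qed
  then have int_phi: "integrable lborel (\<lambda>x. h x * phi \<alpha> x)"
    unfolding h_def by (intro integrable_weighted_square[OF assms(1) v _ c v_supp v_bound]) (simp add: phi_def[abs_def])
  have int_h: "integrable lborel h"
    using integrable_weighted_square[OF assms(1) v _ c v_supp v_bound, of "\<lambda>_. 1" 1] by (simp add: h_def)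
  have "(LINT x|lborel. (v x)\<^sup>2 * (1 - x\<^sup>2) powr - \<alpha> * ((\<beta> - (1 + x) powr \<alpha> - (1 - x) powr \<alpha>) / \<alpha>)) =
      (LINT x|lborel. (\<beta> - 2 powr \<alpha>) / \<alpha> * h x + 1 / \<alpha> * (h x * phi \<alpha> x))"
    by (intro Bochner_Integration.integral_cong refl)
       (simp add: h_def phi_def field_simps assms(1)[THEN less_imp_neq, symmetric])
  also have "\<dots> = (\<beta> - 2 powr \<alpha>) / \<alpha> * (LINT x|lborel. h x) + 1 / \<alpha> * (LINT x|lborel. h x * phi \<alpha> x)"
    using int_h int_phi by simp
  also have "(\<beta> - 2 powr \<alpha>) / \<alpha> = 2 powr \<alpha> * kappa 1 \<alpha>"
    unfolding kappa_1[OF assms(1)] \<beta>_def by simp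
  also have "(LINT x|lborel. h x) = (LINT x:{-1<..<1}|lborel. (u x)\<^sup>2 * (1 - x\<^sup>2) powr (- \<alpha>))"
    unfolding set_lebesgue_integral_def h_def v_def
    by (intro Bochner_Integration.integral_cong refl) (simp add: indicator_def)
  also have "(LINT x|lborel. h x * phi \<alpha> x) = (LINT x:{-1<..<1}|lborel. (u x)\<^sup>2 * phi \<alpha> x * (1 - x\<^sup>2) powr (- \<alpha>))"
    unfolding set_lebesgue_integral_def h_def v_def
    by (intro Bochner_Integration.integral_cong refl) (simp add: indicator_def)
  finally have R: "(LINT x|lborel. (v x)\<^sup>2 * (1 - x\<^sup>2) powr - \<alpha> * ((\<beta> - (1 + x) powr \<alpha> - (1 - x) powr \<alpha>) / \<alpha>)) =
      2 powr \<alpha> * kappa 1 \<alpha> * (LINT x:{-1<..<1}|lborel. (u x)\<^sup>2 * (1 - x\<^sup>2) powr (- \<alpha>)) +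
      1 / \<alpha> * (LINT x:{-1<..<1}|lborel. (u x)\<^sup>2 * phi \<alpha> x * (1 - x\<^sup>2) powr (- \<alpha>))" .
  show ?thesis
    using hardy_identity_compact_support[OF assms(1,2) v c v_supp v_bound]
    unfolding lhs rhs \<beta>_def[symmetric] R by (simp add: add.assoc)
qed

end
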